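(* Let $p$ be an odd prime and $d\geq 1$ an integer. Then $n(d,p)\leq(d+1)(2p-2)+1$.
   Context: A coloring of the vertex set of a simplex by $d+1$ colors is a partition into pairwise disjoint color classes $C_1,\ldots,C_{d+1}$; a face $\sigma$ is rainbow if $|\sigma\cap C_i|\leq 1$ for all $i$. $n(d,r)$ denotes the smallest $n$ such that for every affine map $f:\Delta_{n-1}\to\mathbb{R}^d$ and every coloring of the vertex set of the simplex $\Delta_{n-1}$ by $d+1$ colors with each color class of size at least $r$, there exist $r$ pairwise disjoint rainbow faces $\sigma_1,\ldots,\sigma_r$ of $\Delta_{n-1}$ with $f(\sigma_1)\cap\cdots\cap f(\sigma_r)\neq\emptyset$. *)

theory Defs
  imports "HOL-Homology.Simplices" "HOL-Library.Extended_Nat"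
    "HOL-Computational_Algebra.Primes"
begin

text \<open>
  The simplex with \<open>n \<ge> 1\<close> vertices is \<^term>\<open>standard_simplex (n - 1)\<close>, a set of
  barycentric coordinate functions. Its vertices are identified with the indices in
  \<^term>\<open>{..<n}\<close>, and a face with the set of its vertices.
\<close>

definition simplex_face :: "nat \<Rightarrow> nat set \<Rightarrow> (nat \<Rightarrow> real) set" where
  "simplex_face n \<sigma> = {x \<in> standard_simplex (n - 1). \<forall>i. i \<notin> \<sigma> \<longrightarrow> x i = 0}"

definition affine_map_on_simplex :: "nat \<Rightarrow> ((nat \<Rightarrow> real) \<Rightarrow> real ^ 'd) \<Rightarrow> bool" where
  "affine_map_on_simplex n f \<longleftrightarrow>
     (\<forall>x \<in> standard_simplex (n - 1). \<forall>y \<in> standard_simplex (n - 1). \<forall>t \<in> {0..1}.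
        f (\<lambda>i. (1 - t) * x i + t * y i) = (1 - t) *\<^sub>R f x + t *\<^sub>R f y)"

definition vertex_coloring :: "nat \<Rightarrow> nat \<Rightarrow> (nat \<Rightarrow> nat set) \<Rightarrow> bool" where
  "vertex_coloring n k C \<longleftrightarrow>
     disjoint_family_on C {1..k} \<and> (\<Union>i\<in>{1..k}. C i) = {..<n}"

definition rainbow :: "nat \<Rightarrow> (nat \<Rightarrow> nat set) \<Rightarrow> nat set \<Rightarrow> bool" where
  "rainbow k C \<sigma> \<longleftrightarrow> (\<forall>i\<in>{1..k}. card (\<sigma> \<inter> C i) \<le> 1)"

definition colored_tverberg_property :: "'d::finite itself \<Rightarrow> nat \<Rightarrow> nat \<Rightarrow> bool" where
  "colored_tverberg_property (_ :: 'd itself) r n \<longleftrightarrow>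
     (\<forall>(f :: (nat \<Rightarrow> real) \<Rightarrow> real ^ 'd) C.
        affine_map_on_simplex n f \<longrightarrow>
        vertex_coloring n (CARD('d) + 1) C \<longrightarrow>
        (\<forall>i\<in>{1..CARD('d) + 1}. r \<le> card (C i)) \<longrightarrow>
        (\<exists>\<sigma> :: nat \<Rightarrow> nat set.
           (\<forall>j\<in>{1..r}. \<sigma> j \<subseteq> {..<n} \<and> rainbow (CARD('d) + 1) C (\<sigma> j)) \<and>
           disjoint_family_on \<sigma> {1..r} \<and>
           (\<Inter>j\<in>{1..r}. f ` simplex_face n (\<sigma> j)) \<noteq> {}))"

text \<open>
  The number $n(d,r)$, with the dimension given as $d$ = \<^term>\<open>CARD('d)\<close>.
  For $n < (d+1)r$ no coloring by $d+1$ colors has all classes of size at least $r$, so the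
  property holds vacuously there; the minimum is taken over the remaining $n$.
  With values in \<^typ>\<open>enat\<close>, the minimum is \<open>\<infinity>\<close> if no such $n$ exists, so that
  a finite upper bound includes the existence of such an $n$.
\<close>

definition colored_tverberg_number :: "'d::finite itself \<Rightarrow> nat \<Rightarrow> enat" where
  "colored_tverberg_number (_ :: 'd itself) r =
     Inf (enat ` {n. (CARD('d) + 1) * r \<le> n \<and> colored_tverberg_property TYPE('d) r n})"

end

theory Submission
  imports Defs "Jordan_Normal_Form.Determinant"
begin

text \<open>
  Some color has at least \<open>2p - 1\<close> points. Keep \<open>p - 1\<close> points \<open>A\<close> of it and \<open>p - 1\<close> points of each
  other color. The chessboard complex of \<open>p\<close> rows (the faces \<open>\<sigma>\<^sub>i\<close>) and \<open>p - 1\<close> columns carries a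
  fundamental cycle, and the join of these cycles over all colors is a cycle \<open>Z\<close> of dimension \<open>N - 1\<close>,
  \<open>N = (p - 1)(d + 1)\<close>. Following Sarkaria, map the vertex \<open>v\<close> in row \<open>i\<close> to
  \<open>w\<^sub>i \<otimes> (f v, 1) \<in> \<real>\<^sup>N\<close>, where \<open>w\<^sub>0 + \<dots> + w\<^bsub>p-1\<^esub> = 0\<close>; a simplex whose image contains \<open>0\<close> in its hull
  gives the required faces. If there is none, the degree of \<open>Z\<close> around \<open>0\<close> vanishes, because the
  factor of \<open>Z\<close> belonging to \<open>A\<close> bounds once the \<open>p\<close> spare columns of its color are added.
  On the other hand the degree of a \<open>\<int>/p\<close>-equivariant map on \<open>Z\<close> is independent of the map modulo
  \<open>p\<close>, since a homotopy changes it by full orbits, and for the map \<open>v \<mapsto> w\<^sub>i \<otimes> e\<^sub>k\<close> (\<open>k\<close> the color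
  of \<open>v\<close>) it is \<open>\<plusminus>(p - 1)!\<^bsup>d+1\<^esup>\<close>.
\<close>

section \<open>Alternating sums over deletions\<close>

text \<open>With \<open>p\<close> rows, \<open>p - 1\<close> columns per color do two things:
  removing a rook leaves two free rows, which makes the chain a cycle, and every color misses a row,
  which makes the reference degree computable. Filling spends one spare column per row, so one color
  needs \<open>(p - 1) + p\<close> points, and pigeonhole gives the bound. The degree is purely
  algebraic: the cochain \<open>orient\<close>, coned with an auxiliary apex, counts signed
  crossings of a ray. It is a cocycle only in general position, while the given vectors may be
  degenerate and a perturbation has to commute with the cyclic action. Hence positions are perturbed
  in row 0 only, their translates follow, and facts about hulls pass to a nearby generic
  configuration by compactness. Oddness of \<open>p\<close> makes the row shift an even permutation
  and gives the action determinant 1, so cycle and cochain are both invariant. Primality ensures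
  that \<open>p\<close> does not divide a power of \<open>(p - 1)!\<close>.\<close>

primrec del_alt :: "'a list \<Rightarrow> ('a \<Rightarrow> 'a list \<Rightarrow> int) \<Rightarrow> int" where
  "del_alt [] = (\<lambda>f. 0)"
| "del_alt (x # xs) = (\<lambda>f. f x xs - del_alt xs (\<lambda>y ys. f y (x # ys)))"

primrec del_sum :: "'a list \<Rightarrow> ('a \<Rightarrow> 'a list \<Rightarrow> int) \<Rightarrow> int" where
  "del_sum [] = (\<lambda>f. 0)"
| "del_sum (x # xs) = (\<lambda>f. f x xs + del_sum xs (\<lambda>y ys. f y (x # ys)))"

lemma del_alt_cong:
  assumes "\<And>x ys. mset xs = add_mset x (mset ys) \<Longrightarrow> f x ys = g x ys"
  shows "del_alt xs f = del_alt xs g"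
  using assms
proof (induction xs arbitrary: f g)
  case (Cons a xs)
  have "del_alt xs (\<lambda>y ys. f y (a # ys)) = del_alt xs (\<lambda>y ys. g y (a # ys))"
    by (rule Cons.IH) (rule Cons.prems, simp)
  then show ?case using Cons.prems[of a xs] by simp
qed simp

lemma del_sum_cong:
  assumes "\<And>x ys. mset xs = add_mset x (mset ys) \<Longrightarrow> f x ys = g x ys"
  shows "del_sum xs f = del_sum xs g"
  using assms
proof (induction xs arbitrary: f g)
  case (Cons a xs)
  have "del_sum xs (\<lambda>y ys. f y (a # ys)) = del_sum xs (\<lambda>y ys. g y (a # ys))"
    by (rule Cons.IH) (rule Cons.prems, simp)
  then show ?case using Cons.prems[of a xs] by simp
qed simp

lemma del_alt_add: "del_alt xs (\<lambda>x ys. f x ys + g x ys) = del_alt xs f + del_alt xs g"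
  by (induction xs arbitrary: f g) auto

lemma del_alt_cmult: "del_alt xs (\<lambda>x ys. k * f x ys) = k * del_alt xs f"
  by (induction xs arbitrary: f) (auto simp: algebra_simps)

lemma del_alt_minus: "del_alt xs (\<lambda>x ys. - f x ys) = - del_alt xs f"
  using del_alt_cmult[of xs "-1" f] by simp

lemma del_alt_diff: "del_alt xs (\<lambda>x ys. f x ys - g x ys) = del_alt xs f - del_alt xs g"
  using del_alt_add[of xs f "\<lambda>x ys. - g x ys"] by (simp add: del_alt_minus)

lemma del_alt_zero: "del_alt xs (\<lambda>x ys. 0) = 0"
  using del_alt_cmult[of xs 0 "\<lambda>_ _. 0"] by simp

lemma del_sum_cmult: "del_sum xs (\<lambda>x ys. k * f x ys) = k * del_sum xs f"
  by (induction xs arbitrary: f) (auto simp: algebra_simps)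

lemma del_alt_sum_swap:
  "del_alt xs (\<lambda>x xs'. del_sum ys (\<lambda>y ys'. f x xs' y ys')) =
   del_sum ys (\<lambda>y ys'. del_alt xs (\<lambda>x xs'. f x xs' y ys'))"
proof (induction ys arbitrary: f)
  case (Cons a ys)
  then show ?case by (simp add: del_alt_add)
qed (simp add: del_alt_zero)

text \<open>Both orders of deleting two elements leave the same list, but in one of them the
  position of the second has dropped by one. The cancellation of faces in
  \<open>rook_bd_cycle\<close> rests on this, via \<open>del_alt_rook\<close>.\<close>

lemma del_alt_twice:
  "del_alt xs (\<lambda>x ys. del_alt ys (\<lambda>y zs. f x y zs)) = - del_alt xs (\<lambda>x ys. del_alt ys (\<lambda>y zs. f y x zs))"
proof (induction xs arbitrary: f)
  case (Cons a xs)
  show ?case using Cons[of "\<lambda>x y zs. f x y (a # zs)"]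
    by (simp add: del_alt_diff)
qed simp

lemma del_alt_snoc:
  "del_alt (xs @ [x]) f = del_alt xs (\<lambda>y ys. f y (ys @ [x])) + (-1) ^ length xs * f x xs"
  by (induction xs arbitrary: f) auto

lemma del_alt_map: "del_alt (map g xs) f = del_alt xs (\<lambda>y ys. f (g y) (map g ys))"
  by (induction xs arbitrary: f) auto

lemma del_sum_const:
  assumes "\<And>x ys. mset xs = add_mset x (mset ys) \<Longrightarrow> f x ys = c"
  shows "del_sum xs f = int (length xs) * c"
proof -
  have "del_sum xs (\<lambda>_ _. c) = int (length xs) * c" for c
    by (induction xs) (auto simp: algebra_simps)
  then show ?thesis using del_sum_cong[of xs f "\<lambda>_ _. c"] assms by simp
qed

section \<open>Chains on chessboards\<close>

text \<open>A chain is represented by the functional \<open>E \<mapsto> E(chain)\<close> it induces on cochains \<open>E\<close>,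
  which are functions on lists of vertices. Thus \<open>bd s E\<close> is the value of \<open>E\<close> on the boundary
  of the simplex \<open>s\<close>, the empty simplex included.\<close>
primrec bd :: "'a list \<Rightarrow> ('a list \<Rightarrow> int) \<Rightarrow> int" where
  "bd [] = (\<lambda>E. 0)"
| "bd (x # xs) = (\<lambda>E. E xs - bd xs (\<lambda>t. E (x # t)))"

lemma bd_diff: "bd s (\<lambda>t. E t - E' t) = bd s E - bd s E'"
  by (induction s arbitrary: E E') (auto simp: algebra_simps)

lemma bd_append:
  "bd (s @ t) E = bd s (\<lambda>s'. E (s' @ t)) + (-1) ^ length s * bd t (\<lambda>t'. E (s @ t'))"
  by (induction s arbitrary: E) (auto simp: algebra_simps)

lemma bd_map: "bd (map g s) E = bd s (\<lambda>t. E (map g t))"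
  by (induction s arbitrary: E) auto

text \<open>\<open>rook A R\<close> is the signed sum over all placements of one rook in each column of \<open>A\<close>, in distinct
  rows of \<open>R\<close>; for \<open>length R = length A + 1\<close> it is the fundamental cycle of the chessboard complex.\<close>
primrec rook :: "'c list \<Rightarrow> 'r list \<Rightarrow> (('r \<times> 'c) list \<Rightarrow> int) \<Rightarrow> int" where
  "rook [] = (\<lambda>R E. E [])"
| "rook (a # A) = (\<lambda>R E. del_alt R (\<lambda>r R'. rook A R' (\<lambda>s. E ((r, a) # s))))"

definition placements :: "'c list \<Rightarrow> 'r list \<Rightarrow> ('r \<times> 'c) list set" where
  "placements A R = {s. mset (map snd s) = mset A \<and> mset (map fst s) \<subseteq># mset R}"

lemma distinct_fst_placements:
  assumes "s \<in> placements A R" "distinct R"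
  shows "distinct (map fst s)" "set (map fst s) \<subseteq> set R"
proof -
  have sub: "mset (map fst s) \<subseteq># mset R" using assms(1) by (simp add: placements_def)
  then obtain zs where "mset R = mset (map fst s @ zs)"
    by (metis ex_mset mset_append subset_mset.le_iff_add)
  then have "distinct (map fst s @ zs)" using assms(2) mset_eq_imp_distinct_iff by blast
  then show "distinct (map fst s)" by simp
  show "set (map fst s) \<subseteq> set R" using sub by (metis set_mset_mono set_mset_mset)
qed

lemma rook_cong:
  assumes "\<And>s. s \<in> placements A R \<Longrightarrow> E s = E' s"
  shows "rook A R E = rook A R E'"
  using assms
proof (induction A arbitrary: R E E')
  case Nil
  then show ?case by (simp add: placements_def)
next
  case (Cons a A)
  show ?case
    by (simp, intro del_alt_cong Cons.IH Cons.prems) (auto simp: placements_def)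
qed

lemma rook_cmult: "rook A R (\<lambda>s. k * E s) = k * rook A R E"
  by (induction A arbitrary: R E) (auto simp: del_alt_cmult)

lemma rook_add: "rook A R (\<lambda>s. E s + E' s) = rook A R E + rook A R E'"
  by (induction A arbitrary: R E E') (auto simp: del_alt_add)

lemma rook_minus: "rook A R (\<lambda>s. - E s) = - rook A R E"
  using rook_cmult[of A R "-1" E] by simp

lemma rook_diff: "rook A R (\<lambda>s. E s - E' s) = rook A R E - rook A R E'"
  using rook_add[of A R E "\<lambda>s. - E' s"] by (simp add: rook_minus)

lemma rook_zero: "rook A R (\<lambda>s. 0) = 0"
  using rook_cmult[of A R 0 "\<lambda>_. 0"] by simp

definition alternating :: "('a list \<Rightarrow> int) \<Rightarrow> bool" where
  "alternating E \<longleftrightarrow> (\<forall>xs x y ys. E (xs @ x # y # ys) = - E (xs @ y # x # ys))"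

lemma alternatingD: "alternating E \<Longrightarrow> E (xs @ x # y # ys) = - E (xs @ y # x # ys)"
  unfolding alternating_def by blast

lemma alternating_Cons: "alternating E \<Longrightarrow> alternating (\<lambda>s. E (z # s))"
  unfolding alternating_def by (metis append_Cons)

text \<open>Placements are split by whether row \<open>r0\<close> is used. If not, it shifts the
  position of each of the \<open>length A\<close> deleted rows by one. If it serves column
  \<open>a\<close>, the sign from the columns before \<open>a\<close> cancels the sign of moving
  \<open>(r0, a)\<close> to the front, so \<open>del_sum\<close> carries no sign.\<close>

lemma rook_expand_row:
  assumes "alternating E"
  shows "rook A (r0 # R) E = (-1) ^ length A * rook A R E
    + del_sum A (\<lambda>a A'. rook A' R (\<lambda>s. E ((r0, a) # s)))"
  using assms
proof (induction A arbitrary: R E)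
  case (Cons a A)
  have sw: "E ((r, a) # (r0, a') # s) = - E ((r0, a') # (r, a) # s)" for r a' s
    using alternatingD[OF Cons.prems, of "[]" "(r, a)" "(r0, a')" s] by simp
  have "rook (a # A) (r0 # R) E = rook A R (\<lambda>s. E ((r0, a) # s))
     - del_alt R (\<lambda>r R'. rook A (r0 # R') (\<lambda>s. E ((r, a) # s)))"
    by simp
  also have "\<dots> = rook A R (\<lambda>s. E ((r0, a) # s))
     - del_alt R (\<lambda>r R'. (-1) ^ length A * rook A R' (\<lambda>s. E ((r, a) # s))
         + del_sum A (\<lambda>a' A'. rook A' R' (\<lambda>s. E ((r, a) # (r0, a') # s))))"
    by (simp only: Cons.IH[OF alternating_Cons[OF Cons.prems]])
  also have "\<dots> = rook A R (\<lambda>s. E ((r0, a) # s)) + (-1) ^ length (a # A) * rook (a # A) R E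
     - del_sum A (\<lambda>a' A'. del_alt R (\<lambda>r R'. rook A' R' (\<lambda>s. E ((r, a) # (r0, a') # s))))"
    by (simp add: del_alt_add del_alt_cmult del_alt_sum_swap)
  also have "\<dots> = rook A R (\<lambda>s. E ((r0, a) # s)) + (-1) ^ length (a # A) * rook (a # A) R E
     + del_sum A (\<lambda>a' A'. rook (a # A') R (\<lambda>s. E ((r0, a') # s)))"
  proof -
    have "del_sum A (\<lambda>a' A'. del_alt R (\<lambda>r R'. rook A' R' (\<lambda>s. E ((r, a) # (r0, a') # s))))
      = del_sum A (\<lambda>a' A'. -1 * del_alt R (\<lambda>r R'. rook A' R' (\<lambda>s. E ((r0, a') # (r, a) # s))))"
    proof (rule del_sum_cong)
      fix a' A'
      have "del_alt R (\<lambda>r R'. rook A' R' (\<lambda>s. E ((r, a) # (r0, a') # s)))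
        = del_alt R (\<lambda>r R'. rook A' R' (\<lambda>s. - E ((r0, a') # (r, a) # s)))"
        by (intro del_alt_cong rook_cong sw)
      then show "del_alt R (\<lambda>r R'. rook A' R' (\<lambda>s. E ((r, a) # (r0, a') # s)))
        = -1 * del_alt R (\<lambda>r R'. rook A' R' (\<lambda>s. E ((r0, a') # (r, a) # s)))"
        by (simp add: rook_minus del_alt_minus)
    qed
    then show ?thesis by (simp only: del_sum_cmult rook.simps)
  qed
  finally show ?case by simp
qed simp

text \<open>Moving the extra deletion behind those of the rooks costs \<open>(-1) ^ length A\<close>
  by \<open>del_alt_twice\<close>. It then acts on a list of one row, with value 1, or of two rows,
  with value 1 - 1 = 0.\<close>

lemma del_alt_rook:
  shows "length R = Suc (length A) \<Longrightarrow> del_alt R (\<lambda>r R'. rook A R' E) = (-1) ^ length A * rook A R E"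
    and "length R = Suc (Suc (length A)) \<Longrightarrow> del_alt R (\<lambda>r R'. rook A R' E) = 0"
proof (induction A arbitrary: R E)
  case Nil
  { case 1 then show ?case by (cases R) auto }
  { case 2 then show ?case by (cases R; cases "tl R") auto }
next
  case (Cons a A)
  have eq: "del_alt R (\<lambda>r R'. rook (a # A) R' E)
     = - del_alt R (\<lambda>r R'. del_alt R' (\<lambda>_ R''. rook A R'' (\<lambda>s. E ((r, a) # s))))" for R E
    by simp (rule del_alt_twice)
  { case 1
    have "del_alt R (\<lambda>r R'. del_alt R' (\<lambda>_ R''. rook A R'' (\<lambda>s. E ((r, a) # s))))
      = del_alt R (\<lambda>r R'. (-1) ^ length A * rook A R' (\<lambda>s. E ((r, a) # s)))"
      using 1 by (intro del_alt_cong Cons.IH(1)) (auto dest: arg_cong[of _ _ size])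
    then show ?case unfolding eq by (simp add: del_alt_cmult) }
  { case 2
    have "del_alt R (\<lambda>r R'. del_alt R' (\<lambda>_ R''. rook A R'' (\<lambda>s. E ((r, a) # s))))
      = del_alt R (\<lambda>r R'. 0)"
      using 2 by (intro del_alt_cong Cons.IH(2)) (auto dest: arg_cong[of _ _ size])
    then show ?case unfolding eq by (simp add: del_alt_zero) }
qed

text \<open>On a square board the removal of a rook leaves one free row, so faces do not cancel:
  those missing column \<open>a\<close> form the cycle on the remaining columns.\<close>

lemma rook_bd_square:
  "length R = length A \<Longrightarrow>
   rook A R (\<lambda>s. bd s E) = - ((-1) ^ length A) * del_sum A (\<lambda>a A'. rook A' R E)"
proof (induction A arbitrary: R E)
  case (Cons a A)
  have "del_alt R (\<lambda>r R'. rook A R' (\<lambda>s. bd s (\<lambda>t. E ((r, a) # t))))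
      = del_alt R (\<lambda>r R'. - ((-1) ^ length A) * del_sum A (\<lambda>a' A'. rook A' R' (\<lambda>t. E ((r, a) # t))))"
    using Cons.prems by (intro del_alt_cong Cons.IH) (auto dest: arg_cong[of _ _ size])
  then show ?case
    using Cons.prems
    by (simp add: rook_diff del_alt_diff del_alt_rook(1) del_alt_cmult del_alt_minus del_alt_sum_swap
        algebra_simps)
qed simp

text \<open>Removing a rook leaves two free rows, and the two ways to put it back have opposite
  signs, as on an oriented pseudomanifold.\<close>

lemma rook_bd_cycle:
  "length R = Suc (length A) \<Longrightarrow> rook A R (\<lambda>s. bd s E) = 0"
proof (induction A arbitrary: R E)
  case (Cons a A)
  have "del_alt R (\<lambda>r R'. rook A R' (\<lambda>s. bd s (\<lambda>t. E ((r, a) # t)))) = del_alt R (\<lambda>r R'. 0)"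
    using Cons.prems by (intro del_alt_cong Cons.IH) (auto dest: arg_cong[of _ _ size])
  then show ?case
    using Cons.prems
    by (simp add: rook_diff del_alt_diff del_alt_rook(2) del_alt_zero)
qed simp

text \<open>\<open>rook\<close> behaves like a determinant in its rows; the sign is that of a cyclic
  shift of \<open>length R + 1\<close> rows.\<close>

lemma rook_rotate:
  "length R = length A \<Longrightarrow> rook A (R @ [x]) E = (-1) ^ length R * rook A (x # R) E"
proof (induction A arbitrary: R E)
  case (Cons a A)
  have "del_alt R (\<lambda>r R'. rook A (R' @ [x]) (\<lambda>s. E ((r, a) # s)))
      = del_alt R (\<lambda>r R'. (-1) ^ length A * rook A (x # R') (\<lambda>s. E ((r, a) # s)))"
  proof (rule del_alt_cong)
    fix r R' assume "mset R = add_mset r (mset R')"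
    then have "length R' = length A" using Cons.prems by (auto dest: arg_cong[of _ _ size])
    then show "rook A (R' @ [x]) (\<lambda>s. E ((r, a) # s)) = (-1) ^ length A * rook A (x # R') (\<lambda>s. E ((r, a) # s))"
      using Cons.IH by metis
  qed
  then show ?case
    using Cons.prems by (simp add: del_alt_snoc del_alt_cmult algebra_simps)
qed simp

lemma rook_map: "rook A (map g R) E = rook A R (\<lambda>s. E (map (map_prod g id) s))"
  by (induction A arbitrary: R E) (auto simp: del_alt_map)

lemma rook_too_few: "length R < length A \<Longrightarrow> rook A R E = 0"
proof (induction A arbitrary: R E)
  case (Cons a A)
  have "del_alt R (\<lambda>r R'. rook A R' (\<lambda>s. E ((r, a) # s))) = del_alt R (\<lambda>r R'. 0)"
    using Cons.prems by (intro del_alt_cong Cons.IH) (auto dest: arg_cong[of _ _ size])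
  then show ?case by (simp add: del_alt_zero)
qed simp

text \<open>Coning off with the fresh vertex \<open>(r, b)\<close>, where \<open>r\<close> is the first row, reduces the rows by one.\<close>
lemma rook_fill:
  assumes "alternating E" "length R = Suc (length A)" "length R \<le> length B" "distinct R" "distinct (A @ B)"
    and "\<And>t. \<lbrakk>length t = length R; distinct (map fst t); distinct (map snd t);
           set t \<subseteq> set R \<times> set (A @ B)\<rbrakk> \<Longrightarrow> bd t E = 0"
  shows "rook A R E = 0"
  using assms
proof (induction R arbitrary: A B E)
  case (Cons r R)
  then obtain b B' where B: "B = b # B'" by (cases B) auto
  have len: "length R = length A" using Cons.prems by simp
  \<comment> \<open>The difference of the two cochains vanishes on boundaries of cells avoiding row
    \<open>r\<close> and columns \<open>a\<close> and \<open>b\<close>, so the induction hypothesis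
    applies to it with \<open>A'\<close> and \<open>B'\<close>. Each row uses up one spare column,
    whence \<open>length R \<le> length B\<close>.\<close>
  have "rook A' R (\<lambda>s. E ((r, a) # s)) = rook A' R (\<lambda>s. E ((r, b) # s))"
    if A': "mset A = add_mset a (mset A')" for a A'
  proof -
    let ?E = "\<lambda>s. E ((r, a) # s) - E ((r, b) # s)"
    have alt: "alternating ?E"
      unfolding alternating_def
    proof (intro allI)
      fix xs x y ys
      show "?E (xs @ x # y # ys) = - ?E (xs @ y # x # ys)"
        using alternatingD[OF Cons.prems(1), of "(r, a) # xs" x y ys]
          alternatingD[OF Cons.prems(1), of "(r, b) # xs" x y ys] by simp
    qed
    have sA: "set A = insert a (set A')" using A' by (metis set_mset_add_mset_insert set_mset_mset)
    have dA: "distinct A'" "a \<notin> set A'"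
    proof -
      have "distinct (a # A')"
        using Cons.prems(5) A' mset_eq_imp_distinct_iff[of A "a # A'"] by simp
      then show "distinct A'" "a \<notin> set A'" by auto
    qed
    have *: "bd t (\<lambda>s. E ((r, c) # s)) = E t"
      if "length t = length R" "distinct (map fst t)" "distinct (map snd t)"
         "set t \<subseteq> set R \<times> set (A' @ B')" "c = a \<or> c = b" for t c
    proof -
      have "bd ((r, c) # t) E = 0"
      proof (rule Cons.prems(6))
        have "r \<notin> fst ` set t" "c \<notin> snd ` set t"
          using that Cons.prems(4,5) dA by (auto simp: B sA)
        then show "distinct (map fst ((r, c) # t))" "distinct (map snd ((r, c) # t))"
          using that by auto
        show "set ((r, c) # t) \<subseteq> set (r # R) \<times> set (A @ B)"
          using that by (auto simp: B sA)
      qed (use that in simp)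
      then show ?thesis by simp
    qed
    have "rook A' R ?E = 0"
      using alt Cons.prems(2-5) A' dA *
      by (intro Cons.IH[of ?E A' B']) (auto simp: B sA bd_diff dest: arg_cong[of _ _ size])
    then show ?thesis by (simp add: rook_diff)
  qed
  then have "del_sum A (\<lambda>a A'. rook A' R (\<lambda>s. E ((r, a) # s)))
      = del_sum A (\<lambda>a A'. rook A' R (\<lambda>s. E ((r, b) # s)))"
    by (rule del_sum_cong)
  \<comment> \<open>Vanishing on the boundary of the cone \<open>(r, b) # s\<close> turns
    \<open>E s\<close> into the boundary value of the coned cochain.\<close>
  moreover have "rook A R (\<lambda>s. bd s (\<lambda>t. E ((r, b) # t))) = rook A R E"
  proof (rule rook_cong)
    fix s assume s: "s \<in> placements A R"
    then have snd: "mset (map snd s) = mset A" by (simp add: placements_def)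
    have 1: "length s = length R" "distinct (map snd s)" "set (map snd s) = set A"
      using len mset_eq_length[OF snd] mset_eq_imp_distinct_iff[OF snd] mset_eq_setD[OF snd] Cons.prems(5)
      by auto
    then have 2: "distinct (map fst s)" "set (map fst s) \<subseteq> set R"
      using distinct_fst_placements[OF s] Cons.prems(4) by auto
    have 3: "set s \<subseteq> set R \<times> set A" using 1(3) 2(2) by force
    have "bd ((r, b) # s) E = 0"
    proof (rule Cons.prems(6))
      have "r \<notin> fst ` set s" "b \<notin> snd ` set s"
        using 2 3 Cons.prems(4,5) by (auto simp: B)
      then show "distinct (map fst ((r, b) # s))" "distinct (map snd ((r, b) # s))"
        using 1(2) 2(1) Cons.prems(5) by auto
      show "set ((r, b) # s) \<subseteq> set (r # R) \<times> set (A @ B)"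
        using 3 by (auto simp: B)
    qed (use 1 in simp)
    then show "bd s (\<lambda>t. E ((r, b) # t)) = E s" by simp
  qed
  ultimately have "rook A (r # R) E = (-1) ^ length A * rook A R E + del_sum A (\<lambda>a A'. rook A' R (\<lambda>s. E ((r, b) # s)))"
    and "rook A R E = - ((-1) ^ length A) * del_sum A (\<lambda>a A'. rook A' R (\<lambda>s. E ((r, b) # s)))"
    using rook_expand_row[OF Cons.prems(1), of A r R] rook_bd_square[OF len, of "\<lambda>s. E ((r, b) # s)"]
    by presburger+
  moreover have "(-1) ^ length A * (-1) ^ length A = (1 :: int)"
    by (simp flip: power_mult_distrib)
  \<comment> \<open>With \<open>m\<close> the sign, the second relation turns \<open>m * y\<close>
    into \<open>- z\<close>, so the two contributions cancel.\<close>
  moreover have "x = 0" if "x = m * y + z" "y = - m * z" "m * m = 1" for x y z m :: int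
  proof -
    have "m * y = - (m * m) * z" using that(2) by (simp add: mult.assoc)
    then show ?thesis using that(1,3) by simp
  qed
  ultimately show ?case by blast
qed simp

text \<open>The join of the chains \<open>rook A R\<close> over all \<open>A\<close> in the list.\<close>
primrec chess :: "'c list list \<Rightarrow> 'r list \<Rightarrow> (('r \<times> 'c) list \<Rightarrow> int) \<Rightarrow> int" where
  "chess [] = (\<lambda>R E. E [])"
| "chess (A # As) = (\<lambda>R E. rook A R (\<lambda>s. chess As R (\<lambda>t. E (s @ t))))"

primrec cells :: "'c list list \<Rightarrow> 'r list \<Rightarrow> ('r \<times> 'c) list set" where
  "cells [] = (\<lambda>R. {[]})"
| "cells (A # As) = (\<lambda>R. {s @ t | s t. s \<in> placements A R \<and> t \<in> cells As R})"

lemma chess_cong: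
  assumes "\<And>s. s \<in> cells As R \<Longrightarrow> E s = E' s"
  shows "chess As R E = chess As R E'"
  using assms
proof (induction As arbitrary: E E')
  case (Cons A As)
  have "chess As R (\<lambda>t. E (s @ t)) = chess As R (\<lambda>t. E' (s @ t))" if "s \<in> placements A R" for s
    using that by (intro Cons.IH Cons.prems) auto
  then show ?case by (simp cong: rook_cong)
qed simp

lemma chess_cmult: "chess As R (\<lambda>s. k * E s) = k * chess As R E"
  by (induction As arbitrary: E) (auto simp: rook_cmult)

lemma chess_add: "chess As R (\<lambda>s. E s + E' s) = chess As R E + chess As R E'"
  by (induction As arbitrary: E E') (auto simp: rook_add)

lemma chess_minus: "chess As R (\<lambda>s. - E s) = - chess As R E"
  using chess_cmult[of As R "-1" E] by simp

lemma chess_diff: "chess As R (\<lambda>s. E s - E' s) = chess As R E - chess As R E'"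
  using chess_add[of As R E "\<lambda>s. - E' s"] by (simp add: chess_minus)

lemma chess_zero: "chess As R (\<lambda>s. 0) = 0"
  using chess_cmult[of As R 0 "\<lambda>_. 0"] by simp

lemma chess_sum: "finite I \<Longrightarrow> chess As R (\<lambda>s. \<Sum>i\<in>I. E i s) = (\<Sum>i\<in>I. chess As R (E i))"
  by (induction I rule: finite_induct) (auto simp: chess_add chess_zero)

lemma chess_bd_swap: "chess As R (\<lambda>t. bd s (\<lambda>s'. E s' t)) = bd s (\<lambda>s'. chess As R (\<lambda>t. E s' t))"
  by (induction s arbitrary: E) (auto simp: chess_diff chess_zero)

lemma chess_bd_cycle:
  assumes "\<forall>A\<in>set As. length R = Suc (length A)"
  shows "chess As R (\<lambda>s. bd s E) = 0"
  using assms
  by (induction As arbitrary: E)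
    (simp_all add: bd_append chess_add chess_cmult chess_bd_swap rook_bd_cycle)

lemma chess_rotate:
  assumes "\<forall>A\<in>set As. length A = length R" "even (length R)"
  shows "chess As (R @ [x]) E = chess As (x # R) E"
  using assms by (induction As arbitrary: E) (simp_all add: rook_rotate)

lemma chess_map: "chess As (map g R) E = chess As R (\<lambda>s. E (map (map_prod g id) s))"
  by (induction As arbitrary: E) (simp_all add: rook_map)

lemma alternating_chess:
  assumes "alternating E"
  shows "alternating (\<lambda>s. chess As R (\<lambda>t. E (s @ t)))"
  unfolding alternating_def
proof (intro allI)
  fix xs x y ys
  have "chess As R (\<lambda>t. E ((xs @ x # y # ys) @ t)) = chess As R (\<lambda>t. - E ((xs @ y # x # ys) @ t))"
    using alternatingD[OF assms, of xs x y] by (intro chess_cong) simp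
  then show "chess As R (\<lambda>t. E ((xs @ x # y # ys) @ t)) = - chess As R (\<lambda>t. E ((xs @ y # x # ys) @ t))"
    by (simp only: chess_minus)
qed

text \<open>Evaluating the second factor on the cycle over \<open>As\<close> reduces the join to
  \<open>rook_fill\<close>: in the Leibniz rule \<open>bd_append\<close> the boundary of that factor
  contributes nothing.\<close>

lemma chess_fill:
  assumes "alternating E" "length R = Suc (length A)" "length R \<le> length B" "distinct R" "distinct (A @ B)"
    and cyc: "\<forall>A\<in>set As. length R = Suc (length A)"
    and bd: "\<And>s t. \<lbrakk>length s = length R; distinct (map fst s); distinct (map snd s);
           set s \<subseteq> set R \<times> set (A @ B); t \<in> cells As R\<rbrakk> \<Longrightarrow> bd (s @ t) E = 0"
  shows "chess (A # As) R E = 0"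
proof -
  have "bd s (\<lambda>s. chess As R (\<lambda>t. E (s @ t))) = 0"
    if "length s = length R" "distinct (map fst s)" "distinct (map snd s)"
       "set s \<subseteq> set R \<times> set (A @ B)" for s
  proof -
    have "chess As R (\<lambda>t. bd (s @ t) E) = chess As R (\<lambda>t. 0)"
      using that by (intro chess_cong bd)
    then show ?thesis
      by (simp add: bd_append chess_add chess_cmult chess_bd_swap chess_bd_cycle[OF cyc] chess_zero)
  qed
  then show ?thesis
    using rook_fill[OF alternating_chess[OF assms(1)] assms(2-5)] by simp
qed

text \<open>Repeated expansion along the first row lists each of the \<open>fact (length R)\<close>
  placements in row order, so all enter with sign +1; the term that omits a row of the square board
  vanishes by \<open>rook_too_few\<close>.\<close>

lemma rook_sorted:
  assumes "alternating E" "length A = length R" "\<And>A'. mset A' = mset A \<Longrightarrow> E (zip R A') = C"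
  shows "rook A R E = fact (length R) * C"
  using assms
proof (induction R arbitrary: A E)
  case (Cons r R)
  have "rook A' R (\<lambda>s. E ((r, a) # s)) = fact (length R) * C" if A': "mset A = add_mset a (mset A')" for a A'
  proof (rule Cons.IH)
    show "alternating (\<lambda>s. E ((r, a) # s))" by (rule alternating_Cons[OF Cons.prems(1)])
    show "length A' = length R" using arg_cong[OF A', of size] Cons.prems(2) by simp
    show "E ((r, a) # zip R A'') = C" if "mset A'' = mset A'" for A''
      using Cons.prems(3)[of "a # A''"] that A' by simp
  qed
  then have "del_sum A (\<lambda>a A'. rook A' R (\<lambda>s. E ((r, a) # s))) = int (length A) * (fact (length R) * C)"
    by (rule del_sum_const)
  then show ?case
    using rook_expand_row[OF Cons.prems(1), of A r R] Cons.prems(2) rook_too_few[of R A E]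
    by (simp add: algebra_simps)
qed simp

text \<open>Listing the rooks by row instead of by column fixes the order of the vertices, so that
  no sign remains to be tracked.\<close>

primrec sorted_cells :: "'c list list \<Rightarrow> 'r list \<Rightarrow> ('r \<times> 'c) list set" where
  "sorted_cells [] = (\<lambda>R. {[]})"
| "sorted_cells (A # As) = (\<lambda>R. {zip R A' @ t | A' t. mset A' = mset A \<and> t \<in> sorted_cells As R})"

text \<open>As \<open>E\<close> vanishes on cells using row \<open>r\<close>, each board reduces to
  a square one on \<open>R\<close>. Evenness of \<open>length R\<close> makes the sign in
  \<open>rook_expand_row\<close> positive.\<close>

lemma chess_sorted:
  assumes "alternating E" "\<forall>A\<in>set As. length A = length R" "even (length R)"
    and "\<And>s. s \<in> cells As (r # R) \<Longrightarrow> r \<in> fst ` set s \<Longrightarrow> E s = 0"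
    and "\<And>s. s \<in> sorted_cells As R \<Longrightarrow> E s = C"
  shows "chess As (r # R) E = fact (length R) ^ length As * C"
  using assms
proof (induction As arbitrary: E)
  case (Cons A As)
  let ?H = "\<lambda>s. chess As (r # R) (\<lambda>t. E (s @ t))"
  have alt: "alternating ?H" by (rule alternating_chess[OF Cons.prems(1)])
  have "rook A' R (\<lambda>s. ?H ((r, a) # s)) = 0" if A': "mset A = add_mset a (mset A')" for a A'
  proof -
    have "?H ((r, a) # s) = 0" if "s \<in> placements A' R" for s
    proof -
      have "(r, a) # s \<in> placements A (r # R)" using that A' by (auto simp: placements_def)
      then have "((r, a) # s) @ t \<in> cells (A # As) (r # R)" if "t \<in> cells As (r # R)" for t
        using that by (simp only: cells.simps) blast
      then have "?H ((r, a) # s) = chess As (r # R) (\<lambda>t. 0)"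
        by (intro chess_cong Cons.prems(4)) auto
      then show ?thesis by (simp only: chess_zero)
    qed
    then have "rook A' R (\<lambda>s. ?H ((r, a) # s)) = rook A' R (\<lambda>s. 0)" by (intro rook_cong)
    then show ?thesis by (simp only: rook_zero)
  qed
  then have "del_sum A (\<lambda>a A'. rook A' R (\<lambda>s. ?H ((r, a) # s))) = 0"
    using del_sum_const[of A "\<lambda>a A'. rook A' R (\<lambda>s. ?H ((r, a) # s))" 0] by simp
  then have "rook A (r # R) ?H = rook A R ?H"
    using rook_expand_row[OF alt, of A r R] Cons.prems(2,3) by simp
  also have "\<dots> = fact (length R) * (fact (length R) ^ length As * C)"
  proof (rule rook_sorted[OF alt])
    show "length A = length R" using Cons.prems(2) by simp
    fix A' assume A': "mset A' = mset A"
    have "zip R A' \<in> placements A (r # R)"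
      using A' Cons.prems(2) mset_eq_length[OF A'] by (simp add: placements_def del: mset_map)
    then have cell: "zip R A' @ t \<in> cells (A # As) (r # R)" if "t \<in> cells As (r # R)" for t
      using that by (simp only: cells.simps) blast
    show "?H (zip R A') = fact (length R) ^ length As * C"
    proof (rule Cons.IH)
      show "alternating (\<lambda>t. E (zip R A' @ t))"
        unfolding alternating_def
      proof (intro allI)
        fix xs x y ys
        show "E (zip R A' @ xs @ x # y # ys) = - E (zip R A' @ xs @ y # x # ys)"
          using alternatingD[OF Cons.prems(1), of "zip R A' @ xs" x y ys] by simp
      qed
      show "E (zip R A' @ t) = 0" if "t \<in> cells As (r # R)" "r \<in> fst ` set t" for t
        using cell[OF that(1)] that(2) by (intro Cons.prems(4)) auto
      show "E (zip R A' @ t) = C" if "t \<in> sorted_cells As R" for t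
        using that A' by (intro Cons.prems(5)) auto
    qed (use Cons.prems(2,3) in auto)
  qed
  finally show ?case by simp
qed simp

lemma cells_fst: "s \<in> cells As R \<Longrightarrow> fst ` set s \<subseteq> set R"
proof (induction As arbitrary: s)
  case (Cons A As)
  then obtain s1 s2 where "s = s1 @ s2" "s1 \<in> placements A R" "s2 \<in> cells As R" by auto
  then show ?case using Cons.IH[of s2] mset_subset_eqD[of "mset (map fst s1)" "mset R"]
    by (auto simp: placements_def)
qed simp

text \<open>The cyclic shift of the rows permutes the summands freely, so each orbit contributes \<open>p\<close> equal terms.\<close>
lemma chess_invariant_dvd:
  assumes "As \<noteq> []" "\<forall>A\<in>set As. length A = p - 1" "odd p" "p \<ge> 2"
    and inv: "\<And>s. s \<in> cells As [0..<p] \<Longrightarrow> H (map (map_prod (\<lambda>i. Suc i mod p) id) s) = H s"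
  shows "int p dvd chess As [0..<p] H"
proof -
  let ?R = "[0..<p]" and ?g = "\<lambda>i. Suc i mod p"
  \<comment> \<open>Grouping the cells by the row of their first vertex replaces a choice of orbit
    representatives: the shift carries the group of row \<open>j\<close> to that of row
    \<open>Suc j\<close>.\<close>
  define K where "K i = chess As ?R (\<lambda>s. if fst (hd s) = i then H s else 0)" for i
  have ne: "s \<noteq> []" "fst (hd s) < p" if "s \<in> cells As ?R" for s
  proof -
    obtain A As' where As: "As = A # As'" using assms(1) by (cases As) auto
    show "s \<noteq> []" using that assms(2,4) by (auto simp: As placements_def)
    then show "fst (hd s) < p" using cells_fst[OF that] by (cases s) auto
  qed
  have R: "?R = 0 # [1..<p]" "map ?g ?R = [1..<p] @ [0]"
  proof -
    show "?R = 0 # [1..<p]" using assms(4) by (simp add: upt_conv_Cons)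
    show "map ?g ?R = [1..<p] @ [0]"
      using assms(4) by (intro nth_equalityI) (auto simp: nth_append not_less_eq less_Suc_eq)
  qed
  have rot: "chess As ?R E = chess As ?R (\<lambda>s. E (map (map_prod ?g id) s))" for E
  proof -
    have "chess As ?R (\<lambda>s. E (map (map_prod ?g id) s)) = chess As ([1..<p] @ [0]) E"
      by (simp only: chess_map[symmetric] R(2))
    also have "\<dots> = chess As ?R E"
      using assms(2-4) unfolding R(1) by (intro chess_rotate) auto
    finally show ?thesis by simp
  qed
  have "K (Suc j) = K j" if "Suc j < p" for j
  proof -
    have "K (Suc j) = chess As ?R (\<lambda>s. if fst (hd (map (map_prod ?g id) s)) = Suc j
        then H (map (map_prod ?g id) s) else 0)"
      unfolding K_def by (rule rot)
    also have "\<dots> = K j"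
      unfolding K_def
    proof (rule chess_cong)
      fix s assume s: "s \<in> cells As ?R"
      have "?g (fst (hd s)) = Suc j \<longleftrightarrow> fst (hd s) = j"
        using ne(2)[OF s] that by (cases "Suc (fst (hd s)) = p") auto
      then show "(if fst (hd (map (map_prod ?g id) s)) = Suc j
        then H (map (map_prod ?g id) s) else 0) = (if fst (hd s) = j then H s else 0)"
        using ne(1)[OF s] by (simp add: inv[OF s] hd_map)
    qed
    finally show ?thesis .
  qed
  then have K: "K i = K 0" if "i < p" for i
    using that by (induction i) auto
  have "chess As ?R H = chess As ?R (\<lambda>s. \<Sum>i<p. if fst (hd s) = i then H s else 0)"
    using ne(2) by (intro chess_cong) (simp add: sum.delta')
  also have "\<dots> = (\<Sum>i<p. K i)" unfolding K_def by (rule chess_sum) simp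
  also have "\<dots> = (\<Sum>i<p. K 0)" by (intro sum.cong refl K) simp
  finally show ?thesis by simp
qed

text \<open>The prism operator: the value of \<open>h\<close> on the chain homotopy from \<open>F\<close> to \<open>G\<close> applied to \<open>s\<close>.\<close>
primrec prism :: "('a \<Rightarrow> 'b) \<Rightarrow> ('a \<Rightarrow> 'b) \<Rightarrow> 'a list \<Rightarrow> ('b list \<Rightarrow> int) \<Rightarrow> int" where
  "prism F G [] = (\<lambda>h. 0)"
| "prism F G (x # s) = (\<lambda>h. h (F x # G x # map G s) - prism F G s (\<lambda>t. h (F x # t)))"

lemma prism_diff: "prism F G s (\<lambda>t. h t - h' t) = prism F G s h - prism F G s h'"
  by (induction s arbitrary: h h') auto

text \<open>The identity dP + Pd = G - F for the prism operator P, evaluated on a cochain.\<close>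

lemma prism_homotopy:
  "h (map G s) - h (map F s) = prism F G s (\<lambda>t. bd t h) + bd s (\<lambda>s. prism F G s h)"
proof (induction s arbitrary: h)
  case (Cons x s)
  show ?case using Cons[of "\<lambda>t. h (F x # t)"]
    by (simp add: prism_diff bd_diff bd_map)
qed simp

text \<open>The lists in the hypothesis are all the prism simplices: vertex \<open>k\<close> occurs
  under both \<open>F\<close> and \<open>G\<close>, so the two slices overlap in one entry.\<close>

lemma prism_cong:
  assumes "\<And>k. k < length s \<Longrightarrow> h (map F (take (Suc k) s) @ map G (drop k s)) = h' (map F (take (Suc k) s) @ map G (drop k s))"
  shows "prism F G s h = prism F G s h'"
  using assms
proof (induction s arbitrary: h h')
  case (Cons x s)
  have "prism F G s (\<lambda>t. h (F x # t)) = prism F G s (\<lambda>t. h' (F x # t))"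
    using Cons.prems[of "Suc k" for k] by (intro Cons.IH) auto
  then show ?case using Cons.prems[of 0] by simp
qed simp

lemma prism_map:
  assumes "\<And>x. F (g x) = g' (F x)" "\<And>x. G (g x) = g' (G x)"
  shows "prism F G (map g s) h = prism F G s (\<lambda>t. h (map g' t))"
  by (induction s arbitrary: h) (auto simp: assms comp_def)

section \<open>Orientation and its cocycle property\<close>

definition omit :: "nat \<Rightarrow> 'a list \<Rightarrow> 'a list" where
  "omit i xs = take i xs @ drop (Suc i) xs"

lemma length_omit: "i < length xs \<Longrightarrow> length (omit i xs) = length xs - 1"
  by (simp add: omit_def)

lemma nth_omit: "i < length xs \<Longrightarrow> j < length xs - 1 \<Longrightarrow> omit i xs ! j = xs ! (if j < i then j else Suc j)"
  by (auto simp: omit_def nth_append min_def)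

lemma map_omit: "map f (omit i xs) = omit i (map f xs)"
  by (simp add: omit_def take_map drop_map)

lemma omit_omit:
  assumes "i < j" "j < length xs"
  shows "omit i (omit j xs) = omit (j - 1) (omit i xs)"
  using assms
  by (intro nth_equalityI) (auto simp: length_omit nth_omit)

lemma bd_conv_sum: "bd s E = (\<Sum>j<length s. (-1) ^ j * E (omit j s))"
proof (induction s arbitrary: E)
  case (Cons x s)
  show ?case
    by (simp add: Cons sum.lessThan_Suc_shift omit_def sum_negf del: sum.lessThan_Suc)
qed simp

type_synonym vect = "nat \<Rightarrow> real"

definition vol :: "vect list \<Rightarrow> real" where
  "vol ys = det (mat (length ys) (length ys) (\<lambda>(i, r). (ys ! i) r))"

lemma vol_expand:
  "vol ys = (\<Sum>\<pi> | \<pi> permutes {0..<length ys}. of_int (sign \<pi>) * (\<Prod>i = 0..<length ys. (ys ! i) (\<pi> i)))"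
  unfolding vol_def det_def
  by (auto intro!: sum.cong prod.cong dest: permutes_in_image)

lemma vol_swap: "vol (xs @ x # y # ys) = - vol (xs @ y # x # ys)"
proof -
  define n where "n = Suc (Suc (length xs + length ys))"
  let ?k = "length xs"
  let ?A = "mat n n (\<lambda>(i, r). ((xs @ y # x # ys) ! i) r)"
  have nth: "(xs @ x # y # ys) ! i =
      (xs @ y # x # ys) ! (if ?k = i then Suc ?k else if Suc ?k = i then ?k else i)" for i
    by (auto simp: nth_append nth_Cons')
  have "mat n n (\<lambda>(i, r). ((xs @ x # y # ys) ! i) r) = swaprows ?k (Suc ?k) ?A"
    by (rule eq_matI) (auto simp: nth, auto simp: n_def)
  moreover have "det (swaprows ?k (Suc ?k) ?A) = - det ?A"
    by (rule det_swaprows[of _ n]) (auto simp: n_def)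
  ultimately show ?thesis unfolding vol_def by (simp add: n_def)
qed

lemma vol_kernel:
  assumes "vol ys \<noteq> 0" "\<And>r. r < length ys \<Longrightarrow> (\<Sum>i<length ys. c i * (ys ! i) r) = 0" "i < length ys"
  shows "c i = 0"
proof (rule ccontr)
  let ?n = "length ys"
  let ?A = "mat ?n ?n (\<lambda>(i, r). (ys ! i) r)"
  assume "c i \<noteq> 0"
  then have "vec ?n c \<noteq> 0\<^sub>v ?n" using assms(3) by (metis index_vec index_zero_vec(1))
  moreover have "transpose_mat ?A *\<^sub>v vec ?n c = 0\<^sub>v ?n"
    using assms(2) by (intro eq_vecI) (auto simp: scalar_prod_def atLeast0LessThan mult.commute)
  ultimately have "det (transpose_mat ?A) = 0"
    by (subst det_0_iff_vec_prod_zero[of _ ?n]) (auto intro!: exI[of _ "vec ?n c"])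
  then show False using assms(1) det_transpose[of ?A ?n] by (simp add: vol_def)
qed

definition cof :: "vect list \<Rightarrow> nat \<Rightarrow> real" where
  "cof ys i = (-1) ^ i * vol (omit i ys)"

text \<open>Laplace expansion along a duplicated column.\<close>
lemma cof_relation:
  assumes "length ys = Suc N" "r < N"
  shows "(\<Sum>i<Suc N. cof ys i * (ys ! i) r) = 0"
proof -
  let ?A = "mat (Suc N) (Suc N) (\<lambda>(i, s). (ys ! i) (if s = N then r else s))"
  have "det ?A = 0"
    using assms(2) by (intro det_identical_columns[of _ "Suc N" r N]) (auto intro!: eq_vecI)
  moreover have "det ?A = (\<Sum>i<Suc N. ?A $$ (i, N) * cofactor ?A i N)"
    by (rule laplace_expansion_column) auto
  moreover have "?A $$ (i, N) * cofactor ?A i N = (-1) ^ N * (cof ys i * (ys ! i) r)" if "i < Suc N" for i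
  proof -
    have "mat_delete ?A i N = mat (length (omit i ys)) (length (omit i ys)) (\<lambda>(j, s). (omit i ys ! j) s)"
      using that assms by (intro eq_matI) (auto simp: mat_delete_def length_omit nth_omit)
    then show ?thesis
      using that assms by (simp add: cofactor_def cof_def vol_def power_add)
  qed
  ultimately have "0 = (\<Sum>i<Suc N. (-1) ^ N * (cof ys i * (ys ! i) r))"
    by (metis (no_types, lifting) lessThan_iff sum.cong)
  also have "\<dots> = (-1) ^ N * (\<Sum>i<Suc N. cof ys i * (ys ! i) r)"
    by (simp add: sum_distrib_left algebra_simps)
  finally show ?thesis by simp
qed

text \<open>By Cramer's rule the cofactors are the coefficients of the linear relation between \<open>N + 1\<close> vectors,
  so for vectors in general position \<open>orient\<close> is nonzero iff \<open>0\<close> lies in their convex hull.\<close>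
definition orient :: "vect list \<Rightarrow> int" where
  "orient ys = (if \<forall>i<length ys. cof ys i > 0 then 1 else if \<forall>i<length ys. cof ys i < 0 then - 1 else 0)"

lemma cof_swap:
  assumes "k = length xs"
  shows "cof (xs @ x # y # ys) i = - cof (xs @ y # x # ys) (if i = k then Suc k else if i = Suc k then k else i)"
proof -
  consider "i < k" | "i = k" | "i = Suc k" | "Suc k < i" by linarith
  then show ?thesis
  proof cases
    case 1
    then have "omit i (xs @ a # b # ys) = omit i xs @ a # b # ys" for a b
      using assms by (simp add: omit_def)
    with 1 show ?thesis using vol_swap[of "omit i xs" x y ys] by (simp add: cof_def)
  next
    case 4
    then obtain d where d: "i = Suc (Suc (k + d))" using less_iff_Suc_add by auto
    then have "omit i (xs @ a # b # ys) = xs @ a # b # omit d ys" for a b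
      using assms by (simp add: omit_def numeral_3_eq_3)
    with 4 show ?thesis using vol_swap[of "xs" x y "omit d ys"] by (simp add: cof_def)
  qed (auto simp: cof_def omit_def assms)
qed

lemma orient_swap: "orient (xs @ x # y # ys) = - orient (xs @ y # x # ys)"
proof -
  let ?k = "length xs" and ?n = "length (xs @ x # y # ys)"
  define f where "f i = (if i = ?k then Suc ?k else if i = Suc ?k then ?k else i)" for i
  have f: "f (f i) = i" "i < ?n \<Longrightarrow> f i < ?n" for i by (auto simp: f_def)
  have all: "(\<forall>i<?n. Q (f i)) \<longleftrightarrow> (\<forall>i<?n. Q i)" for Q :: "nat \<Rightarrow> bool"
    using f by metis
  have c: "cof (xs @ x # y # ys) i = - cof (xs @ y # x # ys) (f i)" for i
    unfolding f_def by (rule cof_swap) simp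
  let ?z = "xs @ y # x # ys"
  have "(\<forall>i<?n. cof (xs @ x # y # ys) i > 0) \<longleftrightarrow> (\<forall>i<?n. cof ?z i < 0)"
    unfolding c using all[of "\<lambda>i. cof ?z i < 0"] by simp
  moreover have "(\<forall>i<?n. cof (xs @ x # y # ys) i < 0) \<longleftrightarrow> (\<forall>i<?n. cof ?z i > 0)"
    unfolding c using all[of "\<lambda>i. cof ?z i > 0"] by simp
  moreover have "\<not> ((\<forall>i<?n. cof ?z i > 0) \<and> (\<forall>i<?n. cof ?z i < 0))"
    by (auto intro!: exI[of _ 0])
  moreover have "length ?z = ?n" by simp
  ultimately show ?thesis unfolding orient_def by (smt (verit))
qed

text \<open>The sign pattern of a Gale dual of \<open>N + 2\<close> generic vectors in dimension \<open>N\<close>: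
  \<open>D\<close> is the matrix of \<open>2 \<times> 2\<close> minors, and its Pluecker relations make \<open>D i j > 0\<close>
  transitive around a maximum.\<close>
lemma tournament_max_imp_min:
  fixes D :: "nat \<Rightarrow> nat \<Rightarrow> real"
  assumes "n \<ge> 2" and anti: "\<And>i j. D i j = - D j i"
    and ne: "\<And>i j. i < n \<Longrightarrow> j < n \<Longrightarrow> i \<noteq> j \<Longrightarrow> D i j \<noteq> 0"
    and pl: "\<And>i j k m. \<lbrakk>i < n; j < n; k < n; m < n; distinct [i, j, k, m]\<rbrakk> \<Longrightarrow>
      D k m * D i j + D m j * D i k + D j k * D i m = 0"
    and m: "m < n" "\<And>i. i < n \<Longrightarrow> i \<noteq> m \<Longrightarrow> D i m > 0"
  shows "\<exists>j<n. \<forall>i<n. i \<noteq> j \<longrightarrow> D i j < 0"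
proof -
  define I where "I = {..<n} - {m}"
  have "I \<noteq> {}"
  proof -
    have "(if m = 0 then 1 else 0) \<in> I" using assms(1) by (auto simp: I_def)
    then show ?thesis by blast
  qed
  \<comment> \<open>In the Pluecker relation with \<open>m\<close> as fourth index two of the three
    terms are positive, which fixes the sign of the third.\<close>
  have tr: "D i k > 0" if "i \<in> I" "j \<in> I" "k \<in> I" "D i j > 0" "D j k > 0" for i j k
  proof -
    have ij: "i \<noteq> j" "j \<noteq> k" using that(4,5) anti[of i i] anti[of j j] by auto
    have ik: "i \<noteq> k" using that(4,5) anti[of i j] by auto
    have "D k m * D i j + D m j * D i k + D j k * D i m = 0"
      using that ij ik m(1) by (intro pl) (auto simp: I_def)
    moreover have "D k m * D i j > 0" "D j k * D i m > 0" "D j m > 0"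
      using that m(2)[of i] m(2)[of j] m(2)[of k] by (auto simp: I_def)
    ultimately have "D j m * D i k > 0" using anti[of m j] by simp
    then show ?thesis using \<open>D j m > 0\<close> by (simp add: zero_less_mult_iff)
  qed
  have "\<exists>j\<in>I. \<forall>i\<in>I. i \<noteq> j \<longrightarrow> \<not> D i j > 0"
  proof (rule Finite_Set.bex_min_element)
    show "asymp_on I (\<lambda>i j. D i j > 0)"
      by (rule asymp_onI) (metis anti less_asym neg_0_less_iff_less)
    show "transp_on I (\<lambda>i j. D i j > 0)"
      by (rule transp_onI) (use tr in blast)
  qed (use \<open>I \<noteq> {}\<close> in \<open>auto simp: I_def\<close>)
  then obtain j where j: "j \<in> I" "\<And>i. i \<in> I \<Longrightarrow> i \<noteq> j \<Longrightarrow> \<not> D i j > 0" by blast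
  have "D i j < 0" if "i < n" "i \<noteq> j" for i
  proof (cases "i = m")
    case True
    then show ?thesis using m(2)[of j] j(1) anti[of i j] by (auto simp: I_def)
  next
    case False
    then show ?thesis using j(2)[of i] ne[of i j] that j(1) by (fastforce simp: I_def)
  qed
  then show ?thesis using j(1) by (auto simp: I_def)
qed

text \<open>A summand 1 marks a maximum and -1 a minimum of the tournament. Antisymmetry allows at
  most one of each, and \<open>tournament_max_imp_min\<close>, applied to \<open>D\<close> and to
  its negative, makes them occur together.\<close>

lemma tournament_sum:
  fixes D :: "nat \<Rightarrow> nat \<Rightarrow> real"
  assumes "n \<ge> 2" and anti: "\<And>i j. D i j = - D j i"
    and ne: "\<And>i j. i < n \<Longrightarrow> j < n \<Longrightarrow> i \<noteq> j \<Longrightarrow> D i j \<noteq> 0"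
    and pl: "\<And>i j k m. \<lbrakk>i < n; j < n; k < n; m < n; distinct [i, j, k, m]\<rbrakk> \<Longrightarrow>
      D k m * D i j + D m j * D i k + D j k * D i m = 0"
  shows "(\<Sum>j<n. if \<forall>i<n. i \<noteq> j \<longrightarrow> D i j > 0 then 1 else if \<forall>i<n. i \<noteq> j \<longrightarrow> D i j < 0 then -1 else (0::int)) = 0"
proof -
  let ?M = "{j. j < n \<and> (\<forall>i<n. i \<noteq> j \<longrightarrow> D i j > 0)}" and ?m = "{j. j < n \<and> (\<forall>i<n. i \<noteq> j \<longrightarrow> D i j < 0)}"
  have M: "?M = {} \<or> (\<exists>x. ?M = {x})" "?m = {} \<or> (\<exists>x. ?m = {x})"
  proof -
    have "x = y" if "x \<in> ?M" "y \<in> ?M" for x y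
    proof (rule ccontr)
      assume "x \<noteq> y"
      then have "D x y > 0" "D y x > 0" using that by auto
      then show False using anti[of x y] by simp
    qed
    then show "?M = {} \<or> (\<exists>x. ?M = {x})" by blast
    have "x = y" if "x \<in> ?m" "y \<in> ?m" for x y
    proof (rule ccontr)
      assume "x \<noteq> y"
      then have "D x y < 0" "D y x < 0" using that by auto
      then show False using anti[of x y] by simp
    qed
    then show "?m = {} \<or> (\<exists>x. ?m = {x})" by blast
  qed
  have iff: "?M = {} \<longleftrightarrow> ?m = {}"
  proof
    assume m: "?m = {}"
    show "?M = {}"
    proof (rule ccontr)
      assume "?M \<noteq> {}"
      then obtain m where m1: "m < n" "\<And>i. i < n \<Longrightarrow> i \<noteq> m \<Longrightarrow> D i m > 0" by blast
      have "\<exists>j<n. \<forall>i<n. i \<noteq> j \<longrightarrow> D i j < 0"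
        by (rule tournament_max_imp_min[where D = D, OF assms m1])
      then show False using m by blast
    qed
  next
    assume M: "?M = {}"
    have *: "\<exists>j<n. \<forall>i<n. i \<noteq> j \<longrightarrow> - D i j < 0" if "m < n" "\<And>i. i < n \<Longrightarrow> i \<noteq> m \<Longrightarrow> - D i m > 0" for m
    proof (rule tournament_max_imp_min[where D = "\<lambda>i j. - D i j", OF assms(1) _ _ _ that])
      show "- D i j = - (- D j i)" for i j using anti[of i j] by simp
      show "- D i j \<noteq> 0" if "i < n" "j < n" "i \<noteq> j" for i j using ne[OF that] by simp
      show "- D k m * - D i j + - D m j * - D i k + - D j k * - D i m = 0"
        if "i < n" "j < n" "k < n" "m < n" "distinct [i, j, k, m]" for i j k m
        using pl[OF that] by simp
    qed
    show "?m = {}"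
    proof (rule ccontr)
      assume "?m \<noteq> {}"
      then obtain m where m1: "m < n" "\<And>i. i < n \<Longrightarrow> i \<noteq> m \<Longrightarrow> D i m < 0" by blast
      obtain j where j: "j < n" "\<And>i. i < n \<Longrightarrow> i \<noteq> j \<Longrightarrow> - D i j < 0"
        using *[OF m1(1)] m1(2) by force
      then have "j \<in> ?M" by simp
      then show False using M by blast
    qed
  qed
  have disj: "?M \<inter> ?m = {}"
  proof -
    have "\<not> (\<forall>i<n. i \<noteq> j \<longrightarrow> D i j > 0) \<or> \<not> (\<forall>i<n. i \<noteq> j \<longrightarrow> D i j < 0)" for j
    proof -
      obtain i where "i < n" "i \<noteq> j"
        using assms(1) by (metis One_nat_def Suc_1 Suc_le_lessD less_SucI lessI n_not_Suc_n not_less_eq)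
      then show ?thesis by (meson less_asym)
    qed
    then show ?thesis by blast
  qed
  have "(\<Sum>j<n. if \<forall>i<n. i \<noteq> j \<longrightarrow> D i j > 0 then 1 else if \<forall>i<n. i \<noteq> j \<longrightarrow> D i j < 0 then -1 else (0::int))
    = (\<Sum>j<n. (if j \<in> ?M then 1 else 0) - (if j \<in> ?m then 1 else 0))"
    using disj by (intro sum.cong refl) auto
  also have "\<dots> = int (card ?M) - int (card ?m)"
    by (simp add: sum_subtractf sum.If_cases Int_def conj_commute)
  also have "card ?M = card ?m"
  proof -
    have "card A = card B"
      if "A = {} \<or> (\<exists>x. A = {x})" "B = {} \<or> (\<exists>x. B = {x})" "A = {} \<longleftrightarrow> B = {}" for A B :: "nat set"
      using that by auto
    from this[OF M iff] show ?thesis .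
  qed
  finally show ?thesis by simp
qed

text \<open>The position in the full list of the entry found at \<open>i\<close> once position
  \<open>j\<close> is omitted.\<close>

definition skip :: "nat \<Rightarrow> nat \<Rightarrow> nat" where
  "skip j i = (if i < j then i else Suc i)"

lemma skip_range: "j < n \<Longrightarrow> skip j ` {..<n - 1} = {..<n} - {j}"
proof
  assume "j < n"
  then show "skip j ` {..<n - 1} \<subseteq> {..<n} - {j}" by (auto simp: skip_def)
  show "{..<n} - {j} \<subseteq> skip j ` {..<n - 1}"
  proof
    fix i assume i: "i \<in> {..<n} - {j}"
    then have "i = skip j (if i < j then i else i - 1)" "(if i < j then i else i - 1) \<in> {..<n - 1}"
      using \<open>j < n\<close> by (auto simp: skip_def)
    then show "i \<in> skip j ` {..<n - 1}" by (rule image_eqI)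
  qed
qed

lemma inj_skip: "inj_on (skip j) A"
  by (auto simp: inj_on_def skip_def split: if_splits)

lemma sum_omit:
  fixes f :: "nat \<Rightarrow> 'a \<Rightarrow> real"
  assumes "j < length t"
  shows "(\<Sum>i<length t. f i (t ! i)) = f j (t ! j) + (\<Sum>i<length (omit j t). f (skip j i) (omit j t ! i))"
proof -
  have "(\<Sum>i<length t. f i (t ! i)) = f j (t ! j) + (\<Sum>i\<in>{..<length t} - {j}. f i (t ! i))"
    using assms by (intro sum.remove) auto
  also have "(\<Sum>i\<in>{..<length t} - {j}. f i (t ! i)) = (\<Sum>i<length t - 1. f (skip j i) (t ! skip j i))"
    unfolding skip_range[OF assms, symmetric] by (simp add: sum.reindex inj_skip)
  also have "\<dots> = (\<Sum>i<length t - 1. f (skip j i) (omit j t ! i))"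
    using assms by (intro sum.cong refl) (simp add: nth_omit skip_def)
  finally show ?thesis using assms by (simp add: length_omit)
qed

text \<open>The relations of the faces all lie in the 2-dimensional space of linear relations among
  the \<open>N + 2\<close> vectors, so their coefficients are the minors of a Gale dual and
  \<open>tournament_sum\<close> applies. Geometrically, 0 lies in no face or in two, with opposite
  signs.\<close>

lemma orient_cocycle:
  assumes len: "length t = Suc (Suc N)"
    and gen: "\<And>i j. i < j \<Longrightarrow> j < Suc (Suc N) \<Longrightarrow> vol (omit i (omit j t)) \<noteq> 0"
  shows "bd t orient = 0"
proof -
  let ?n = "Suc (Suc N)"
  define D where "D i j = (if i < j then (-1) ^ (i + j) * vol (omit i (omit j t))
    else if j < i then - ((-1) ^ (i + j) * vol (omit j (omit i t))) else 0)" for i j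
  have anti: "D i j = - D j i" for i j by (simp add: D_def add.commute)
  have ne: "D i j \<noteq> 0" if "i < ?n" "j < ?n" "i \<noteq> j" for i j
    using that gen[of i j] gen[of j i] by (auto simp: D_def)
  have Dcof: "D (skip j i) j = (-1) ^ j * cof (omit j t) i" if "j < ?n" "i < Suc N" for i j
    using that omit_omit[of j "Suc i" t] len by (auto simp: D_def skip_def cof_def power_add)
  have rel: "(\<Sum>i<?n. D i j * (t ! i) r) = 0" if "j < ?n" "r < N" for j r
  proof -
    have "(\<Sum>i<?n. D i j * (t ! i) r) = D j j * (t ! j) r + (\<Sum>i<length (omit j t). D (skip j i) j * (omit j t ! i) r)"
      using sum_omit[of j t "\<lambda>i x. D i j * x r"] that len by simp
    also have "\<dots> = (\<Sum>i<Suc N. (-1) ^ j * (cof (omit j t) i * (omit j t ! i) r))"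
      using that len by (simp add: D_def[of j j] length_omit del: sum.lessThan_Suc cong: sum.cong)
       (intro sum.cong, auto simp: Dcof)
    also have "\<dots> = 0"
      using cof_relation[of "omit j t" N r] that len
      by (simp add: length_omit del: sum.lessThan_Suc flip: sum_distrib_left)
    finally show ?thesis .
  qed
  have pl: "D k m * D i j + D m j * D i k + D j k * D i m = 0"
    if "i < ?n" "j < ?n" "k < ?n" "m < ?n" "distinct [i, j, k, m]" for i j k m
  proof -
    \<comment> \<open>A combination of three relations among the vectors, made to vanish at
      \<open>j\<close> and \<open>k\<close>. The \<open>N\<close> vectors left are independent, so
      it vanishes at \<open>i\<close> too, which is the Pluecker relation.\<close>
    define v where "v i = D k m * D i j + D m j * D i k + D j k * D i m" for i
    have v0: "v j = 0" "v k = 0"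
      using anti[of j k] anti[of k m] anti[of m j] by (auto simp: v_def D_def[of j j] D_def[of k k] algebra_simps)
    have vsum: "(\<Sum>i<?n. v i * (t ! i) r) = 0" if "r < N" for r
    proof -
      have "(\<Sum>i<?n. v i * (t ! i) r) = D k m * (\<Sum>i<?n. D i j * (t ! i) r)
         + D m j * (\<Sum>i<?n. D i k * (t ! i) r) + D j k * (\<Sum>i<?n. D i m * (t ! i) r)"
        by (simp add: v_def sum_distrib_left sum.distrib algebra_simps del: sum.lessThan_Suc)
      then show ?thesis using rel \<open>j < ?n\<close> \<open>k < ?n\<close> \<open>m < ?n\<close> that by simp
    qed
    define a b where "a = min j k" and "b = max j k"
    have ab: "a < b" "b < ?n" "v a = 0" "v b = 0" "i \<noteq> a" "i \<noteq> b"
      using that v0 by (auto simp: a_def b_def min_def max_def)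
    let ?u = "omit a (omit b t)"
    have lens: "length (omit b t) = Suc N" "length ?u = N"
      using ab len by (simp_all add: length_omit)
    have "(\<Sum>i<length ?u. v (skip b (skip a i)) * (?u ! i) r) = 0" if "r < N" for r
    proof -
      have "skip b a = a" using ab by (simp add: skip_def)
      then show ?thesis
        using sum_omit[of b t "\<lambda>i x. v i * x r"] sum_omit[of a "omit b t" "\<lambda>i x. v (skip b i) * x r"]
          vsum[OF that] ab len lens by (simp del: sum.lessThan_Suc)
    qed
    then have zero: "v (skip b (skip a i')) = 0" if "i' < N" for i'
      using vol_kernel[OF gen[OF ab(1,2)], of "\<lambda>i. v (skip b (skip a i))" i'] that lens by simp
    have "i \<in> skip b ` {..<Suc N}" using skip_range[of b ?n] ab \<open>i < ?n\<close> by auto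
    then obtain i1 where i1: "i = skip b i1" "i1 < Suc N" by auto
    have "i1 \<noteq> a" using i1 ab by (auto simp: skip_def)
    then have "i1 \<in> skip a ` {..<N}" using skip_range[of a "Suc N"] i1 ab by auto
    then have "v i = 0" using zero i1 by auto
    then show ?thesis by (simp add: v_def)
  qed
  have all: "(\<forall>i<?n. i \<noteq> j \<longrightarrow> Q (D i j)) \<longleftrightarrow> (\<forall>i<Suc N. Q ((-1) ^ j * cof (omit j t) i))" if "j < ?n" for j Q
  proof -
    have "(\<forall>i<?n. i \<noteq> j \<longrightarrow> Q (D i j)) \<longleftrightarrow> (\<forall>i\<in>{..<?n} - {j}. Q (D i j))" by auto
    also have "\<dots> \<longleftrightarrow> (\<forall>i<Suc N. Q (D (skip j i) j))"
      using skip_range[of j ?n] that by (simp flip: skip_range) auto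
    finally show ?thesis using Dcof[OF that] by simp
  qed
  \<comment> \<open>Column \<open>j\<close> of \<open>D\<close> is \<open>(-1) ^ j\<close> times the
    cofactors of the face, so for odd \<open>j\<close> the two sign conditions trade places.\<close>
  have "(-1) ^ j * orient (omit j t) = (if \<forall>i<?n. i \<noteq> j \<longrightarrow> D i j > 0 then 1
      else if \<forall>i<?n. i \<noteq> j \<longrightarrow> D i j < 0 then -1 else (0::int))" if "j < ?n" for j
  proof -
    have l: "length (omit j t) = Suc N" using that len by (simp add: length_omit)
    have "\<not> ((\<forall>i<Suc N. cof (omit j t) i > 0) \<and> (\<forall>i<Suc N. cof (omit j t) i < 0))"
      by (auto intro!: exI[of _ 0])
    then show ?thesis
      unfolding orient_def l all[OF that, of "\<lambda>x. x > 0"] all[OF that, of "\<lambda>x. x < 0"]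
      by (cases "even j") auto
  qed
  then have "bd t orient = (\<Sum>j<?n. if \<forall>i<?n. i \<noteq> j \<longrightarrow> D i j > 0 then 1
      else if \<forall>i<?n. i \<noteq> j \<longrightarrow> D i j < 0 then -1 else (0::int))"
    unfolding bd_conv_sum len by (intro sum.cong refl) auto
  also have "\<dots> = 0"
    using ne pl by (intro tournament_sum anti) auto
  finally show ?thesis .
qed

section \<open>Determinants under linear maps of odd order\<close>

lemma vol_std:
  assumes "length ys = N" "\<And>n r. n < N \<Longrightarrow> r < N \<Longrightarrow> (ys ! n) r = (if n = r then 1 else 0)"
  shows "vol ys = 1"
proof -
  have "mat N N (\<lambda>(i, r). (ys ! i) r) = 1\<^sub>m N"
    using assms by (intro eq_matI) auto
  then show ?thesis using assms(1) by (simp add: vol_def)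
qed

lemma vol_linear_image:
  assumes "length ys = N" "\<And>y r. r < N \<Longrightarrow> \<gamma> y r = (\<Sum>s<N. M r s * y s)"
  shows "vol (map \<gamma> ys) = vol ys * det (mat N N (\<lambda>(s, r). M r s))"
proof -
  have "mat N N (\<lambda>(i, r). (map \<gamma> ys ! i) r) = mat N N (\<lambda>(i, r). (ys ! i) r) * mat N N (\<lambda>(s, r). M r s)"
    using assms by (intro eq_matI) (auto simp: scalar_prod_def atLeast0LessThan mult.commute)
  then show ?thesis
    using assms(1) by (simp add: vol_def det_mult[of _ N])
qed

text \<open>The determinant \<open>k\<close> of the map is real with \<open>k ^ p = 1\<close>, which
  for odd \<open>p\<close> forces \<open>k = 1\<close>.\<close>

lemma vol_finite_order:
  assumes lin: "\<And>y r. r < N \<Longrightarrow> \<gamma> y r = (\<Sum>s<N. M r s * y s)"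
    and ord: "\<And>y. (\<gamma> ^^ p) y = y" and "odd p" and len: "length ys = N"
  shows "vol (map \<gamma> ys) = vol ys"
proof -
  define k where "k = det (mat N N (\<lambda>(s, r). M r s))"
  have step: "vol (map \<gamma> ys) = vol ys * k" if "length ys = N" for ys
    unfolding k_def by (rule vol_linear_image[OF that lin])
  have iter: "vol (map (\<gamma> ^^ m) ys) = vol ys * k ^ m" if "length ys = N" for m ys
  proof (induction m)
    case (Suc m)
    have "map (\<gamma> ^^ Suc m) ys = map \<gamma> (map (\<gamma> ^^ m) ys)" by simp
    then have "vol (map (\<gamma> ^^ Suc m) ys) = vol (map (\<gamma> ^^ m) ys) * k"
      using step[of "map (\<gamma> ^^ m) ys"] that by (simp only: length_map)
    then show ?case using Suc by (simp add: comp_def)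
  qed simp
  define us where "us = map (\<lambda>n r. if n = r then 1 else 0 :: real) [0..<N]"
  have us: "length us = N" "vol us = 1" by (auto simp: us_def intro: vol_std)
  have "map (\<gamma> ^^ p) us = us" by (simp add: ord map_idI)
  then have kp: "k ^ p = 1" using iter[OF us(1), of p] us(2) by simp
  then have "k \<ge> 0" using \<open>odd p\<close> by (metis linorder_not_le not_one_less_zero power_less_zero_eq)
  then have "k = 1" using kp \<open>odd p\<close> by (metis odd_pos power_eq_iff_eq_base power_one zero_le_one)
  then show ?thesis using step[OF len] by simp
qed

lemma orient_linear_image:
  assumes "\<And>zs. length zs = N \<Longrightarrow> vol (map \<gamma> zs) = vol zs" "length ys = Suc N"
  shows "orient (map \<gamma> ys) = orient ys"
proof -
  have "cof (map \<gamma> ys) i = cof ys i" if "i < Suc N" for i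
    using that assms by (simp add: cof_def length_omit flip: map_omit)
  then show ?thesis using assms(2) by (simp add: orient_def)
qed

section \<open>Perturbation to general position\<close>

lemma tendsto_vol:
  assumes "\<And>x r. x \<in> set L \<Longrightarrow> r < length L \<Longrightarrow> ((\<lambda>n. a n x r) \<longlongrightarrow> b x r) F"
  shows "((\<lambda>n. vol (map (a n) L)) \<longlongrightarrow> vol (map b L)) F"
  unfolding vol_expand
  by (auto intro!: tendsto_intros assms dest: permutes_in_image)

lemma vol_line_poly:
  "\<exists>q. \<forall>t. vol (map (\<lambda>x r. a x r + t * (b x r - a x r)) L) = poly q t"
proof -
  let ?q = "\<Sum>\<pi> | \<pi> permutes {0..<length L}. [: of_int (sign \<pi>) :] *
     (\<Prod>i = 0..<length L. [: a (L ! i) (\<pi> i), b (L ! i) (\<pi> i) - a (L ! i) (\<pi> i) :])"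
  have "vol (map (\<lambda>x r. a x r + t * (b x r - a x r)) L) = poly ?q t" for t
    by (simp add: vol_expand poly_sum poly_prod)
  then show ?thesis by blast
qed

text \<open>Conditions are added one at a time. On the line from a term of the old sequence to a
  point where \<open>f\<close> is nonzero, each condition is a nonzero polynomial in
  \<open>t\<close>, so arbitrarily small \<open>t\<close> satisfy all of them.\<close>

lemma generic_sequence:
  fixes c :: "'x \<Rightarrow> vect"
  assumes "finite S"
    and "\<And>f. f \<in> S \<Longrightarrow> \<exists>c. f c \<noteq> 0"
    and poly: "\<And>f c c'. f \<in> S \<Longrightarrow> \<exists>q. \<forall>t. f (\<lambda>x r. c x r + t * (c' x r - c x r)) = poly q (t::real)"
  shows "\<exists>cs. (\<forall>x r. (\<lambda>n. cs n x r) \<longlonglongrightarrow> c x r) \<and> (\<forall>n. \<forall>f\<in>S. f (cs n) \<noteq> (0::real))"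
  using assms
proof (induction S rule: finite_induct)
  case empty
  then show ?case by (intro exI[of _ "\<lambda>_. c"]) auto
next
  case (insert f S)
  have "\<exists>cs. (\<forall>x r. (\<lambda>n. cs n x r) \<longlonglongrightarrow> c x r) \<and> (\<forall>n. \<forall>g\<in>S. g (cs n) \<noteq> 0)"
    by (rule insert.IH) (rule insert.prems; simp)+
  then obtain cs where cs: "\<And>x r. (\<lambda>n. cs n x r) \<longlonglongrightarrow> c x r" "\<And>n g. g \<in> S \<Longrightarrow> g (cs n) \<noteq> 0"
    by blast
  obtain c' where c': "f c' \<noteq> 0" using insert.prems(1) by blast
  define line where "line n t = (\<lambda>x r. cs n x r + t * (c' x r - cs n x r))" for n and t :: real
  have line01: "line n 0 = cs n" "line n 1 = c'" for n by (auto simp: line_def)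
  have fin: "finite {t. g (line n t) = 0}" if g: "g \<in> insert f S" for g n
  proof -
    obtain q where q: "\<And>t. g (line n t) = poly q t"
      using insert.prems(2)[OF g] unfolding line_def by blast
    have "g (line n 0) \<noteq> 0 \<or> g (line n 1) \<noteq> 0"
      using g c' cs(2) by (auto simp: line01)
    then have "q \<noteq> 0" using q by auto
    then show ?thesis using poly_roots_finite[of q] by (simp add: q)
  qed
  have "\<exists>t. 0 < t \<and> t < inverse (real (Suc n)) \<and> (\<forall>g\<in>insert f S. g (line n t) \<noteq> 0)" for n
  proof -
    let ?B = "\<Union>g\<in>insert f S. {t. g (line n t) = 0}"
    have "finite ?B" using fin insert.hyps(1) by blast
    moreover have "infinite {0<..<inverse (real (Suc n))}" by (simp add: infinite_Ioo)
    ultimately have "infinite ({0<..<inverse (real (Suc n))} - ?B)" by (rule Diff_infinite_finite)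
    then obtain t where "t \<in> {0<..<inverse (real (Suc n))} - ?B" by (metis equals0I finite.emptyI)
    then show ?thesis by auto
  qed
  then obtain t where t: "\<And>n. 0 < t n" "\<And>n. t n < inverse (real (Suc n))"
    "\<And>n g. g \<in> insert f S \<Longrightarrow> g (line n (t n)) \<noteq> 0" by metis
  have "t \<longlonglongrightarrow> 0"
    by (rule tendsto_sandwich[OF _ _ tendsto_const LIMSEQ_inverse_real_of_nat])
      (use t in \<open>auto intro!: always_eventually less_imp_le simp del: of_nat_Suc\<close>)
  then have "(\<lambda>n. line n (t n) x r) \<longlonglongrightarrow> c x r + 0 * (c' x r - c x r)" for x r
    unfolding line_def by (intro tendsto_intros cs)
  then show ?case using t(3) by (intro exI[of _ "\<lambda>n. line n (t n)"]) auto
qed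

definition zero_in_hull :: "nat \<Rightarrow> vect list \<Rightarrow> bool" where
  "zero_in_hull N ys \<longleftrightarrow> (\<exists>l. (\<forall>i<length ys. l i \<ge> 0) \<and> (\<Sum>i<length ys. l i) = 1 \<and>
     (\<forall>r<N. (\<Sum>i<length ys. l i * (ys ! i) r) = 0))"

lemma orient_zero_in_hull:
  assumes "orient ys \<noteq> 0" "length ys = Suc N"
  shows "zero_in_hull N ys"
proof -
  define l where "l i = \<bar>cof ys i\<bar>" for i
  have sgn: "(\<forall>i<Suc N. l i = cof ys i) \<or> (\<forall>i<Suc N. l i = - cof ys i)"
    and pos: "\<And>i. i < Suc N \<Longrightarrow> l i > 0"
    using assms unfolding orient_def l_def by (auto split: if_splits)
  have rel: "(\<Sum>i<Suc N. l i * (ys ! i) r) = 0" if "r < N" for r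
    using sgn
  proof
    assume "\<forall>i<Suc N. l i = cof ys i"
    then show ?thesis using cof_relation[OF assms(2) that] by simp
  next
    assume *: "\<forall>i<Suc N. l i = - cof ys i"
    then have "(\<Sum>i<Suc N. l i * (ys ! i) r) = (\<Sum>i<Suc N. - (cof ys i * (ys ! i) r))"
      by (intro sum.cong) auto
    then show ?thesis using cof_relation[OF assms(2) that] by (simp only: sum_negf)
  qed
  define s where "s = (\<Sum>i<Suc N. l i)"
  have "s > 0" unfolding s_def using pos by (intro sum_pos) auto
  have "(\<Sum>i<Suc N. l i / s) = s / s"
    unfolding s_def by (rule sum_divide_distrib[symmetric])
  moreover have "(\<Sum>i<Suc N. l i / s * (ys ! i) r) = 0" if "r < N" for r
  proof -
    have "(\<Sum>i<Suc N. l i / s * (ys ! i) r) = (\<Sum>i<Suc N. l i * (ys ! i) r) / s"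
      unfolding sum_divide_distrib by (intro sum.cong) auto
    then show ?thesis using rel[OF that] by simp
  qed
  moreover have "\<forall>i<Suc N. l i / s \<ge> 0" using pos \<open>s > 0\<close> by (simp add: less_imp_le)
  ultimately show ?thesis
    unfolding zero_in_hull_def assms(2) using \<open>s > 0\<close> by (intro exI[of _ "\<lambda>i. l i / s"]) simp
qed

lemma zero_in_hull_gap:
  assumes "\<not> zero_in_hull N ys"
  shows "\<exists>\<delta>>0. \<forall>l. (\<forall>i<length ys. l i \<ge> 0) \<longrightarrow> (\<Sum>i<length ys. l i) = 1 \<longrightarrow>
     \<delta> \<le> (\<Sum>r<N. \<bar>\<Sum>i<length ys. l i * (ys ! i) r\<bar>)"
proof (cases "ys = []")
  case True
  then show ?thesis by (auto intro: exI[of _ 1])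
next
  case False
  let ?n = "length ys"
  \<comment> \<open>Coefficients beyond the list are pinned to 0, which makes the set compact in the
    space of all functions.\<close>
  define K where "K = PiE UNIV (\<lambda>i. if i < ?n then {0..1} else {0::real}) \<inter> {l. (\<Sum>i<?n. l i) = 1}"
  define \<psi> where "\<psi> l = (\<Sum>r<N. \<bar>\<Sum>i<?n. l i * (ys ! i) r\<bar>)" for l :: "nat \<Rightarrow> real"
  have "compact (PiE UNIV (\<lambda>i. if i < ?n then {0..1} else {0::real}))"
    unfolding compactin_euclidean_iff[symmetric] euclidean_product_topology[symmetric] compactin_PiE by simp
  moreover have "closed {l :: nat \<Rightarrow> real. (\<Sum>i<?n. l i) = 1}"
    by (intro closed_Collect_eq continuous_intros continuous_on_product_coordinates) 
  ultimately have "compact K" unfolding K_def by (rule compact_Int_closed)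
  moreover have "(\<lambda>i. if i = 0 then 1 else 0) \<in> K"
    using False by (auto simp: K_def sum.If_cases)
  moreover have "continuous_on K \<psi>"
    unfolding \<psi>_def
    by (intro continuous_intros continuous_on_subset[OF continuous_on_product_coordinates]) auto
  ultimately obtain l0 where l0: "l0 \<in> K" "\<And>l. l \<in> K \<Longrightarrow> \<psi> l0 \<le> \<psi> l"
    using continuous_attains_inf[of K \<psi>] by blast
  have bound: "l i \<in> {0..1}" if "\<forall>i<?n. l i \<ge> 0" "(\<Sum>i<?n. l i) = 1" "i < ?n" for l :: "nat \<Rightarrow> real" and i
    using that member_le_sum[of i "{..<?n}" l] by auto
  have "l0 i \<in> (if i < ?n then {0..1} else {0})" for i
    using l0(1) by (auto simp: K_def PiE_iff)
  then have "\<forall>i<?n. l0 i \<ge> 0" by (metis atLeastAtMost_iff)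
  then have "\<psi> l0 \<noteq> 0"
    using assms l0(1) unfolding zero_in_hull_def K_def \<psi>_def
    by (auto simp: sum_nonneg_eq_0_iff)
  then have "\<psi> l0 > 0" using sum_nonneg[of "{..<N}"] by (simp add: \<psi>_def less_le)
  moreover have "\<psi> l0 \<le> \<psi> l" if l: "\<forall>i<?n. l i \<ge> 0" "(\<Sum>i<?n. l i) = 1" for l
  proof -
    have "(\<lambda>i. if i < ?n then l i else 0) \<in> K"
      using l bound[OF l] by (auto simp: K_def PiE_iff)
    moreover have "\<psi> (\<lambda>i. if i < ?n then l i else 0) = \<psi> l"
      by (simp add: \<psi>_def)
    ultimately show ?thesis using l0(2) by metis
  qed
  ultimately show ?thesis unfolding \<psi>_def by blast
qed

text \<open>The limit may be degenerate, so the signs of its cofactors cannot be used. Instead the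
  gap from \<open>zero_in_hull_gap\<close> eventually exceeds the perturbation, whose effect is
  bounded since all coefficients are at most 1.\<close>

lemma eventually_orient_zero:
  assumes "length L = Suc N" "\<not> zero_in_hull N (map b L)"
    and lim: "\<And>x r. (\<lambda>n. a n x r) \<longlonglongrightarrow> b x r"
  shows "\<forall>\<^sub>F n in sequentially. orient (map (a n) L) = 0"
proof -
  let ?n = "Suc N"
  obtain \<delta> where \<delta>: "\<delta> > 0" "\<And>l. (\<forall>i<?n. l i \<ge> 0) \<Longrightarrow> (\<Sum>i<?n. l i) = 1 \<Longrightarrow>
     \<delta> \<le> (\<Sum>r<N. \<bar>\<Sum>i<?n. l i * b (L ! i) r\<bar>)"
    using zero_in_hull_gap[OF assms(2)] assms(1) by auto
  define e where "e n = (\<Sum>r<N. \<Sum>i<?n. \<bar>a n (L ! i) r - b (L ! i) r\<bar>)" for n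
  have "e \<longlonglongrightarrow> (\<Sum>r<N. \<Sum>i<?n. \<bar>b (L ! i) r - b (L ! i) r\<bar>)"
    unfolding e_def by (intro tendsto_intros lim)
  then have "\<forall>\<^sub>F n in sequentially. e n < \<delta>" using \<delta>(1) by (intro order_tendstoD) auto
  then show ?thesis
  proof eventually_elim
    case (elim n)
    show ?case
    proof (rule ccontr)
      assume "orient (map (a n) L) \<noteq> 0"
      then have "zero_in_hull N (map (a n) L)"
        using assms(1) by (intro orient_zero_in_hull) auto
      then obtain l where l: "\<forall>i<?n. l i \<ge> 0" "(\<Sum>i<?n. l i) = 1"
        "\<And>r. r < N \<Longrightarrow> (\<Sum>i<?n. l i * a n (L ! i) r) = 0"
        unfolding zero_in_hull_def using assms(1) by auto
      have l1: "l i \<le> 1" if "i < ?n" for i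
        using l(1,2) that member_le_sum[of i "{..<?n}" l] by auto
      have "\<delta> \<le> (\<Sum>r<N. \<bar>\<Sum>i<?n. l i * b (L ! i) r\<bar>)" by (rule \<delta>(2)[OF l(1,2)])
      also have "\<dots> = (\<Sum>r<N. \<bar>\<Sum>i<?n. l i * (a n (L ! i) r - b (L ! i) r)\<bar>)"
        using l(3) by (intro sum.cong refl) (simp add: right_diff_distrib sum_subtractf del: sum.lessThan_Suc)
      also have "\<dots> \<le> e n"
        unfolding e_def
      proof (intro sum_mono order_trans[OF sum_abs])
        fix r i assume "i \<in> {..<?n}"
        then have "0 \<le> l i" "l i \<le> 1" using l(1) l1 by auto
        then show "\<bar>l i * (a n (L ! i) r - b (L ! i) r)\<bar> \<le> \<bar>a n (L ! i) r - b (L ! i) r\<bar>"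
          by (simp add: abs_mult mult_left_le_one_le)
      qed
      finally show False using elim by simp
    qed
  qed
qed

lemma eventually_orient_one:
  assumes "length L = Suc N" "\<And>i. i < Suc N \<Longrightarrow> cof (map b L) i > 0"
    and lim: "\<And>x r. (\<lambda>n. a n x r) \<longlonglongrightarrow> b x r"
  shows "\<forall>\<^sub>F n in sequentially. orient (map (a n) L) = 1"
proof -
  have "\<forall>\<^sub>F n in sequentially. cof (map (a n) L) i > 0" if "i < Suc N" for i
  proof -
    have "(\<lambda>n. cof (map (a n) L) i) \<longlonglongrightarrow> cof (map b L) i"
      unfolding cof_def map_omit[symmetric] by (intro tendsto_intros tendsto_vol lim)
    then show ?thesis using assms(2)[OF that] by (intro order_tendstoD)
  qed
  then have "\<forall>\<^sub>F n in sequentially. \<forall>i\<in>{..<Suc N}. cof (map (a n) L) i > 0"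
    by (intro eventually_ball_finite) auto
  then show ?thesis by eventually_elim (auto simp: orient_def assms(1))
qed

section \<open>The cyclic action on tensors\<close>

text \<open>A vector of \<open>W \<otimes> \<real>\<^sup>D\<close>, where \<open>W\<close> is spanned by \<open>w\<^sub>0, \<dots>, w\<^bsub>p-1\<^esub>\<close> with sum \<open>0\<close>,
  has the coefficient of \<open>w\<^sub>j \<otimes> e\<^sub>k\<close> (\<open>1 \<le> j < p\<close>) at coordinate \<open>k (p - 1) + (j - 1)\<close>;
  \<open>ext\<close> adds the coefficient \<open>0\<close> at \<open>j = 0\<close>, and \<open>act p m\<close> maps \<open>w\<^sub>j\<close> to \<open>w\<^bsub>j+m\<^esub>\<close>.\<close>
definition ext :: "nat \<Rightarrow> vect \<Rightarrow> nat \<Rightarrow> nat \<Rightarrow> real" where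
  "ext p y k j = (if j = 0 then 0 else y (k * (p - 1) + (j - 1)))"

definition act :: "nat \<Rightarrow> nat \<Rightarrow> vect \<Rightarrow> vect" where
  "act p m y r = ext p y (r div (p - 1)) ((r mod (p - 1) + 1 + m * (p - 1)) mod p)
     - ext p y (r div (p - 1)) (m * (p - 1) mod p)"

text \<open>\<open>m * (p - 1)\<close> is congruent to \<open>- m\<close> modulo \<open>p\<close>,
  so the coefficient at \<open>j\<close> comes from \<open>j - m\<close>. The subtracted term
  restores the value 0 at \<open>j = 0\<close>, by a multiple of the vanishing sum of the
  \<open>w\<^sub>j\<close>.\<close>

lemma ext_act:
  assumes "p \<ge> 2" "j < p"
  shows "ext p (act p m y) k j = ext p y k ((j + m * (p - 1)) mod p) - ext p y k (m * (p - 1) mod p)"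
proof (cases j)
  case (Suc i)
  then have "i < p - 1" using assms by simp
  then show ?thesis using Suc assms by (simp add: ext_def[of p "act p m y"] act_def)
qed (simp add: ext_def)

lemma act_act:
  assumes "p \<ge> 2"
  shows "act p m (act p n y) = act p (m + n) y"
proof
  fix r
  have "((a mod p) + b) mod p = (a + b) mod p" for a b :: nat by (rule mod_add_left_eq)
  then show "act p m (act p n y) r = act p (m + n) y r"
    using assms unfolding act_def[of p m] act_def[of p "m + n"]
    by (simp add: ext_act add_mult_distrib add.assoc)
qed

lemma act_mod: "act p (m mod p) y = act p m y"
proof
  fix r
  have "(a + m mod p * b) mod p = (a + m * b) mod p" for a b by (metis mod_add_right_eq mod_mult_left_eq)
  from this[of "r mod (p - 1) + 1"] this[of 0] show "act p (m mod p) y r = act p m y r"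
    unfolding act_def by simp
qed

lemma act_0:
  assumes "p \<ge> 2"
  shows "act p 0 y = y"
proof
  fix r
  have "r mod (p - 1) + 1 < p" using assms mod_less_divisor[of "p - 1" r] by linarith
  then show "act p 0 y r = y r"
    unfolding act_def ext_def by (simp add: div_mult_mod_eq del: One_nat_def)
qed

lemma act_p: "p \<ge> 2 \<Longrightarrow> act p p y = y"
  using act_mod[of p p y] act_0 by simp

lemma act_1_funpow: "p \<ge> 2 \<Longrightarrow> (act p 1 ^^ m) y = act p m y"
  by (induction m) (simp_all add: act_0 act_act)

lemma coord_div_mod:
  assumes "0 < j" "j < (p :: nat)"
  shows "(k * (p - 1) + (j - 1)) div (p - 1) = k" "(k * (p - 1) + (j - 1)) mod (p - 1) = j - 1"
proof -
  have "j - 1 < p - 1" using assms by linarith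
  then show "(k * (p - 1) + (j - 1)) div (p - 1) = k" "(k * (p - 1) + (j - 1)) mod (p - 1) = j - 1"
    by (simp_all del: One_nat_def)
qed

lemma coord_bound:
  assumes "k < D" "i < n"
  shows "k * n + i < n * (D :: nat)"
proof -
  have "k * n + i < Suc k * n" using assms(2) by simp
  also have "\<dots> \<le> D * n" using assms(1) by (intro mult_right_mono) auto
  finally show ?thesis by (simp add: mult.commute)
qed

lemma act_lin:
  assumes "p \<ge> 2" "r < (p - 1) * D"
  shows "act p m y r = (\<Sum>s<(p - 1) * D. act p m (\<lambda>s'. if s' = s then 1 else 0) r * y s)"
proof -
  let ?N = "(p - 1) * D"
  have e: "ext p y k j = (\<Sum>s<?N. ext p (\<lambda>s'. if s' = s then 1 else 0) k j * y s)" if "k < D" "j < p" for k j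
  proof (cases "j = 0")
    case False
    then have "k * (p - 1) + (j - 1) < ?N" using that assms(1) by (intro coord_bound) auto
    then show ?thesis using False by (simp add: ext_def if_distrib[of "\<lambda>x. x * _"] sum.delta cong: if_cong)
  qed (simp add: ext_def)
  have k: "r div (p - 1) < D" using assms by (simp add: less_mult_imp_div_less mult.commute)
  have "p > 0" using assms(1) by simp
  then show ?thesis
    unfolding act_def left_diff_distrib sum_subtractf
    by (intro arg_cong2[where f = minus] e[OF k]) simp_all
qed

lemma orient_act:
  assumes "p \<ge> 2" "odd p" "length ys = Suc ((p - 1) * D)"
  shows "orient (map (act p 1) ys) = orient ys"
proof (rule orient_linear_image[OF _ assms(3)])
  fix zs :: "vect list" assume "length zs = (p - 1) * D"
  then show "vol (map (act p 1) zs) = vol zs"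
    by (intro vol_finite_order[OF act_lin[OF assms(1), of _ D 1] _ assms(2)])
      (simp_all add: act_1_funpow act_p assms(1) del: One_nat_def)
qed

lemma tendsto_act:
  assumes "\<And>r. ((\<lambda>n. a n r) \<longlongrightarrow> b r) F"
  shows "((\<lambda>n. act p m (a n) r) \<longlongrightarrow> act p m b r) F"
  unfolding act_def ext_def
  by (intro tendsto_diff) (auto intro: assms)

text \<open>\<open>w\<^sub>i \<otimes> x\<close> in these coordinates; \<open>w\<^sub>0\<close> is
  minus the sum of the others, whence the first case.\<close>

definition tens :: "nat \<Rightarrow> nat \<Rightarrow> vect \<Rightarrow> vect" where
  "tens p i x r = (if i = 0 then - x (r div (p - 1))
     else if r mod (p - 1) + 1 = i then x (r div (p - 1)) else 0)"

lemma act_tens_0: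
  assumes "p \<ge> 2" "i < p"
  shows "act p i (tens p 0 x) = tens p i x"
proof
  fix r
  define s k where "s = r mod (p - 1)" and "k = r div (p - 1)"
  have s: "s + 1 < p" using assms mod_less_divisor[of "p - 1" r] unfolding s_def by linarith
  have e: "ext p (tens p 0 x) k j = (if j = 0 then 0 else - x k)" if "j < p" for j
    using that coord_div_mod(1)[of j p k] by (simp add: ext_def tens_def del: One_nat_def)
  have i1: "int (i * (p - 1)) = int p * int i - int i"
    using assms(1) by (simp add: of_nat_diff algebra_simps)
  have dvd0: "i * (p - 1) mod p = 0 \<longleftrightarrow> i = 0"
  proof -
    have "p dvd i * (p - 1) \<longleftrightarrow> int p dvd int i" 
      using i1 by (metis dvd_diff_left_iff dvd_triv_left int_dvd_int_iff dvd_diff_right_iff)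
    then show ?thesis using assms(2) by (metis int_dvd_int_iff mod_eq_0_iff_dvd dvd_imp_le dvd_0_right not_le not_gr_zero)
  qed
  have dvd1: "(s + 1 + i * (p - 1)) mod p = 0 \<longleftrightarrow> s + 1 = i"
  proof -
    have "int (s + 1 + i * (p - 1)) = (int s + 1 - int i) + int p * int i"
      using i1 by simp
    then have "p dvd (s + 1 + i * (p - 1)) \<longleftrightarrow> int p dvd int s + 1 - int i"
      by (metis dvd_add_left_iff dvd_triv_left int_dvd_int_iff)
    also have "\<dots> \<longleftrightarrow> int s + 1 - int i = 0"
    proof
      assume "int p dvd int s + 1 - int i"
      moreover have "\<bar>int s + 1 - int i\<bar> < int p" using s assms(2) by auto
      ultimately show "int s + 1 - int i = 0" using dvd_imp_le_int[of "int s + 1 - int i" "int p"] by linarith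
    qed simp
    finally show ?thesis by (simp add: mod_eq_0_iff_dvd) linarith
  qed
  have "act p i (tens p 0 x) r = (if s + 1 = i then 0 else - x k) - (if i = 0 then 0 else - x k)"
    unfolding act_def k_def[symmetric] s_def[symmetric]
    using assms(1) by (subst (1 2) e) (simp_all only: dvd0 dvd1, simp_all)
  then show "act p i (tens p 0 x) r = tens p i x r"
    by (auto simp: tens_def s_def k_def)
qed

text \<open>The core of Sarkaria's trick: the only linear relations among the
  \<open>w\<^sub>i\<close> are the multiples of their sum, so a vanishing sum of tensors has the
  same component at every row.\<close>

lemma tens_relation:
  assumes "p \<ge> 2" "i < p" "k < D"
    and rel: "\<And>r. r < (p - 1) * D \<Longrightarrow> (\<Sum>j<n. l j * tens p (R j) (x j) r) = 0"
  shows "(\<Sum>j<n. if R j = i then l j * x j k else 0) = (\<Sum>j<n. if R j = 0 then l j * x j k else 0)"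
proof (cases "i = 0")
  case False
  let ?r = "k * (p - 1) + (i - 1)"
  have "?r < (p - 1) * D" using assms False by (intro coord_bound) auto
  then have "0 = (\<Sum>j<n. l j * tens p (R j) (x j) ?r)" using rel by simp
  also have "\<dots> = (\<Sum>j<n. (if R j = i then l j * x j k else 0) - (if R j = 0 then l j * x j k else 0))"
  proof (intro sum.cong refl)
    fix j
    have "?r div (p - 1) = k" "?r mod (p - 1) + 1 = i"
      using coord_div_mod[of i p k] assms(2) False by (simp_all del: One_nat_def)
    then show "l j * tens p (R j) (x j) ?r = (if R j = i then l j * x j k else 0) - (if R j = 0 then l j * x j k else 0)"
      using False unfolding tens_def by auto
  qed
  finally show ?thesis by (simp add: sum_subtractf)
qed simp

text \<open>\<open>Init v\<close> and \<open>Ref v\<close> stand for the given and the reference position of the vertex \<open>v\<close>.\<close>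
datatype 'v label = Init 'v | Ref 'v | Apex

text \<open>Only the position in row 0 is free and the other rows are its translates, so every
  choice of \<open>c\<close> gives an equivariant map.\<close>

definition realize :: "nat \<Rightarrow> ('v label \<Rightarrow> vect) \<Rightarrow> nat \<times> 'v label \<Rightarrow> vect" where
  "realize p c = (\<lambda>(i, x). act p i (c x))"

lemma ex_realize_vol_nonzero:
  assumes "p \<ge> 2" "length L = N" "distinct (map snd L)" "fst ` set L \<subseteq> {..<p}"
  shows "\<exists>c. vol (map (realize p c) L) \<noteq> 0"
proof -
  define pos where "pos = the_inv_into {..<N} (\<lambda>n. snd (L ! n))"
  \<comment> \<open>The shift by \<open>p - i\<close> undoes the shift by the row \<open>i\<close>
    of the label, so that the list is realized by the standard basis.\<close>
  define c where "c x = act p (p - fst (L ! pos x)) (\<lambda>r. if pos x = r then 1 else 0)" for x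
  have "inj_on (\<lambda>n. snd (L ! n)) {..<N}"
    using assms(2,3) by (auto simp: inj_on_def distinct_conv_nth)
  then have pos: "pos (snd (L ! n)) = n" if "n < N" for n
    using that unfolding pos_def by (intro the_inv_into_f_f) auto
  have "realize p c (L ! n) = (\<lambda>r. if n = r then 1 else 0)" if "n < N" for n
  proof -
    have "L ! n \<in> set L" using that assms(2) by simp
    then have "fst (L ! n) < p" using assms(4) by auto
    then show ?thesis using pos[OF that] assms(1)
      by (simp add: realize_def case_prod_beta c_def act_act act_p)
  qed
  then have "vol (map (realize p c) L) = 1"
    using assms(2) by (intro vol_std[of _ N]) auto
  then show ?thesis by (intro exI[of _ c]) simp
qed

lemma realize_vol_line_poly:
  "\<exists>q. \<forall>t. vol (map (realize p (\<lambda>x r. c x r + t * (c' x r - c x r))) L) = poly q t"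
proof -
  have "realize p (\<lambda>x r. c x r + t * (c' x r - c x r))
     = (\<lambda>z r. realize p c z r + t * (realize p c' z r - realize p c z r))" for t
    by (auto simp: fun_eq_iff realize_def act_def ext_def algebra_simps)
  then show ?thesis by (simp only: vol_line_poly)
qed

section \<open>The degree argument\<close>

lemma cells_snd: "s \<in> cells As R \<Longrightarrow> mset (map snd s) = mset (concat As)"
  by (induction As arbitrary: s) (auto simp: placements_def)

lemma distinct_snd_append_cells:
  assumes "distinct (map snd s)" "snd ` set s \<subseteq> X" "t \<in> cells As R" "distinct (concat As)"
    "X \<inter> set (concat As) = {}"
  shows "distinct (map snd (s @ t))"
proof -
  note m = cells_snd[OF assms(3)]
  have "distinct (map snd t)" "snd ` set t = set (concat As)"
    using mset_eq_imp_distinct_iff[OF m] mset_eq_setD[OF m] assms(4) by auto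
  then show ?thesis using assms(1,2,5) by (simp only: map_append distinct_append set_map) blast
qed

lemma sorted_cells_nth:
  assumes "\<forall>A\<in>set As. length A = m" "m > 0" "length R = m" "s \<in> sorted_cells As R"
  shows "length s = m * length As"
    and "n < length s \<Longrightarrow> fst (s ! n) = R ! (n mod m) \<and> snd (s ! n) \<in> set (As ! (n div m))"
  using assms
proof (induction As arbitrary: s n)
  case (Cons A As)
  { case 1
    then show ?case using Cons.IH(1) by (auto dest: mset_eq_length) }
  { case 2
    then obtain A' t where s: "s = zip R A' @ t" "mset A' = mset A" "t \<in> sorted_cells As R" by auto
    have l: "length A' = m" using s(2) 2 by (auto dest: mset_eq_length)
    show ?case
    proof (cases "n < m")
      case True
      then have "A' ! n \<in> set A" using l s(2) by (metis mset_eq_setD nth_mem)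
      then show ?thesis using True s l 2 by (simp add: nth_append)
    next
      case False
      then have "n - m < length t" using s l 2 by auto
      then have "fst (t ! (n - m)) = R ! ((n - m) mod m) \<and> snd (t ! (n - m)) \<in> set (As ! ((n - m) div m))"
        using 2 s(3) by (intro Cons.IH(2)) auto
      then show ?thesis using False s l 2 by (simp add: nth_append le_mod_geq le_div_geq)
    qed }
qed auto

text \<open>By \<open>tens_relation\<close> the weight of a color is the same in all rows, and the
  apex counts for every color in row 0. The color of some vertex in row 0 misses another row, which
  forces the apex weight to 0; then each color has weight 0 in the row it misses, hence everywhere,
  although the weights sum to 1.\<close>

lemma ref_not_zero_in_hull:
  assumes "p \<ge> 2" and bd: "\<And>i v. (i, v) \<in> set s \<Longrightarrow> i < p \<and> colour v < D"
    and miss: "\<And>k. k < D \<Longrightarrow> \<exists>i<p. \<forall>v. (i, v) \<in> set s \<longrightarrow> colour v \<noteq> k"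
    and zero: "0 \<in> fst ` set s"
  shows "\<not> zero_in_hull ((p - 1) * D)
    (tens p 0 (\<lambda>_. 1) # map (\<lambda>(i, v). tens p i (\<lambda>k. if k = colour v then 1 else 0)) s)"
proof
  let ?n = "Suc (length s)"
  let ?L = "(0, \<lambda>_. 1) # map (\<lambda>(i, v). (i, \<lambda>k. if k = colour v then 1 else 0 :: real)) s"
  define R x where "R j = fst (?L ! j)" and "x j = snd (?L ! j)" for j
  let ?ys = "tens p 0 (\<lambda>_. 1) # map (\<lambda>(i, v). tens p i (\<lambda>k. if k = colour v then 1 else 0)) s"
  have ys: "?ys ! j = tens p (R j) (x j)" if "j < ?n" for j
    using that by (cases j) (auto simp: R_def x_def case_prod_beta)
  assume "zero_in_hull ((p - 1) * D) ?ys"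
  then obtain l where l: "\<And>j. j < ?n \<Longrightarrow> l j \<ge> 0" "(\<Sum>j<?n. l j) = 1"
    "\<And>r. r < (p - 1) * D \<Longrightarrow> (\<Sum>j<?n. l j * (?ys ! j) r) = 0"
    unfolding zero_in_hull_def by auto
  have rel: "(\<Sum>j<?n. l j * tens p (R j) (x j) r) = 0" if "r < (p - 1) * D" for r
    using l(3)[OF that] ys by (metis (no_types, lifting) lessThan_iff sum.cong)
  define T where "T i k = (\<Sum>j<?n. if R j = i then l j * x j k else 0)" for i k
  have T: "T i k = T 0 k" if "i < p" "k < D" for i k
    unfolding T_def by (rule tens_relation[OF assms(1) that rel])
  have xnn: "x j k \<ge> 0" if "j < ?n" for j k
    using that by (cases j) (auto simp: x_def case_prod_beta)
  have Tz: "l j * x j k = 0" if "T (R j) k = 0" "j < ?n" for j k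
  proof -
    have "\<forall>j'\<in>{..<?n}. (if R j' = R j then l j' * x j' k else 0) = 0"
      using that(1) l(1) xnn unfolding T_def
      by (subst (asm) sum_nonneg_eq_0_iff) (auto simp del: sum.lessThan_Suc)
    then have "(if R j = R j then l j * x j k else 0) = 0" by (rule bspec) (use that(2) in simp)
    then show ?thesis by simp
  qed
  have RxS: "R (Suc j) = fst (s ! j)" "x (Suc j) k = (if k = colour (snd (s ! j)) then 1 else 0)" if "j < length s" for j k
    using that by (simp_all add: R_def x_def case_prod_beta)
  have R0: "R 0 = 0" "x 0 k = 1" for k by (simp_all add: R_def x_def)
  have Tmiss: "T i k = 0"
    if "\<forall>v. (i, v) \<in> set s \<longrightarrow> colour v \<noteq> k" "i \<noteq> 0 \<or> l 0 = 0" for i k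
    unfolding T_def
  proof (rule sum.neutral, rule ballI)
    fix j assume "j \<in> {..<?n}"
    then show "(if R j = i then l j * x j k else 0) = 0"
    proof (cases j)
      case 0
      then show ?thesis using that(2) R0 by auto
    next
      case (Suc j')
      then have "j' < length s" using \<open>j \<in> {..<?n}\<close> by simp
      then have "s ! j' \<in> set s" by simp
      then have "fst (s ! j') = i \<Longrightarrow> colour (snd (s ! j')) \<noteq> k" using that(1) by (metis prod.collapse)
      then show ?thesis using Suc \<open>j' < length s\<close> by (auto simp: RxS)
    qed
  qed
  have l0: "l 0 = 0"
  proof -
    obtain v where v: "(0, v) \<in> set s" using zero by auto
    then have k: "colour v < D" using bd by blast
    then obtain i where i: "i < p" "\<forall>v'. (i, v') \<in> set s \<longrightarrow> colour v' \<noteq> colour v" using miss by blast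
    then have "i \<noteq> 0" using v by metis
    then have "T 0 (colour v) = 0" using Tmiss[OF i(2)] T[OF i(1) k] by simp
    then show ?thesis using Tz[of 0 "colour v"] R0 by simp
  qed
  have T0: "T i k = 0" if "i < p" "k < D" for i k
  proof -
    have "\<exists>i'<p. \<forall>v'. (i', v') \<in> set s \<longrightarrow> colour v' \<noteq> k" by (rule miss[OF that(2)])
    then obtain i' where i': "i' < p" "\<forall>v'. (i', v') \<in> set s \<longrightarrow> colour v' \<noteq> k" by blast
    then have "T i' k = 0" using Tmiss l0 by blast
    then show ?thesis using T[OF that] T[OF i'(1) that(2)] by simp
  qed
  have "l j = 0" if "j < ?n" for j
  proof (cases j)
    case 0
    then show ?thesis using l0 by simp
  next
    case (Suc j')
    then have j': "j' < length s" using that by simp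
    have "(fst (s ! j'), snd (s ! j')) \<in> set s" using j' by simp
    then have "R j < p" "colour (snd (s ! j')) < D" using bd Suc RxS(1)[OF j'] by metis+
    then have "l j * x j (colour (snd (s ! j'))) = 0" using T0 Tz that by blast
    then show ?thesis using Suc RxS(2)[OF j'] by simp
  qed
  then have "(\<Sum>j<?n. l j) = 0" by (intro sum.neutral) simp
  then show False using l(2) by simp
qed

text \<open>The vectors of \<open>s\<close> are the standard basis in order and the apex is minus
  their sum, so every cofactor is 1.\<close>

lemma ref_sorted_cof:
  assumes "p \<ge> 2" "length s = (p - 1) * D" "i < Suc (length s)"
    and nth: "\<And>n. n < length s \<Longrightarrow> fst (s ! n) = n mod (p - 1) + 1 \<and> colour (snd (s ! n)) = n div (p - 1)"
  shows "cof (tens p 0 (\<lambda>_. 1) # map (\<lambda>(i, v). tens p i (\<lambda>k. if k = colour v then 1 else 0)) s) i > 0"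
proof -
  let ?us = "map (\<lambda>(i, v). tens p i (\<lambda>k. if k = colour v then 1 else 0)) s"
  let ?ys = "tens p 0 (\<lambda>_. 1) # ?us"
  let ?N = "length s"
  have us: "(?us ! n) r = (if n = r then 1 else 0)" if "n < ?N" "r < ?N" for n r
  proof -
    have "n = r \<longleftrightarrow> r mod (p - 1) = n mod (p - 1) \<and> r div (p - 1) = n div (p - 1)"
      by (metis div_mod_decomp)
    then show ?thesis using nth[OF that(1)] that by (auto simp: tens_def case_prod_beta)
  qed
  have c0: "cof ?ys 0 = 1"
    using vol_std[of ?us ?N] us by (simp add: cof_def omit_def)
  have "cof ?ys (Suc r) = 1" if r: "r < ?N" for r
  proof -
    have "0 = (\<Sum>n<Suc ?N. cof ?ys n * (?ys ! n) r)"
      using cof_relation[of ?ys ?N r] r by simp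
    also have "\<dots> = - cof ?ys 0 + (\<Sum>n<?N. cof ?ys (Suc n) * (if n = r then 1 else 0))"
      unfolding sum.lessThan_Suc_shift using us r by (simp add: tens_def)
    also have "\<dots> = - 1 + cof ?ys (Suc r)"
      using r c0 by (simp add: if_distrib[of "\<lambda>z. _ * z"] sum.delta cong: if_cong)
    finally show ?thesis by simp
  qed
  then show ?thesis using c0 assms(3) by (cases i) auto
qed

section \<open>Cycle, filling and degree modulo p\<close>

lemma set_omit_subset: "set (omit i xs) \<subseteq> set xs"
  by (auto simp: omit_def dest: in_set_takeD in_set_dropD)

lemma distinct_omit: "distinct xs \<Longrightarrow> distinct (omit i xs)"
  unfolding omit_def by (auto simp: set_take_disj_set_drop_if_distinct)

lemma length_concat_const: "\<forall>xs\<in>set xss. length xs = m \<Longrightarrow> length (concat xss) = m * length xss"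
  by (induction xss) auto

lemma distinct_concat_nth_inj:
  "distinct (concat xss) \<Longrightarrow> i < length xss \<Longrightarrow> j < length xss \<Longrightarrow>
    v \<in> set (xss ! i) \<Longrightarrow> v \<in> set (xss ! j) \<Longrightarrow> i = j"
proof (induction xss arbitrary: i j)
  case (Cons xs xss)
  have "v \<in> set (concat xss)" if "k < length xss" "v \<in> set (xss ! k)" for k
    using that nth_mem by fastforce
  then show ?case using Cons by (cases i; cases j) auto
qed simp

text \<open>The degree argument: the cochain \<open>s \<mapsto> orient (Apex # s)\<close> is evaluated on the cycle
  \<open>chess (A # As)\<close>, once for a generic perturbation of the given vectors (value \<open>0\<close>, since the
  cycle is filled inside the complex) and once for the reference vectors (value a power of
  \<open>(p - 1)!\<close>). Both values agree modulo \<open>p\<close>.\<close>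
lemma chessboard_zero_in_hull:
  fixes x :: "'v \<Rightarrow> vect"
  assumes p: "prime p" "odd p" and A: "length A = p - 1" and As: "\<forall>A'\<in>set As. length A' = p - 1"
    and B: "p \<le> length B" and dist: "distinct (A @ B @ concat As)"
  shows "\<exists>s t. length s = p \<and> distinct (map fst s) \<and> distinct (map snd s) \<and>
    set s \<subseteq> {..<p} \<times> set (A @ B) \<and> t \<in> cells As [0..<p] \<and>
    zero_in_hull ((p - 1) * Suc (length As)) (map (\<lambda>(i, v). tens p i (x v)) (s @ t))"
proof (rule ccontr)
  assume no: "\<not> ?thesis"
  define D N R AA V where "D = Suc (length As)" and "N = (p - 1) * D" and "R = [0..<p]"
    and "AA = A # As" and "V = set (A @ B @ concat As)"
  have p3: "p \<ge> 3" using p prime_ge_2_nat[of p] by (cases "p = 2") auto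
  then have p2: "p \<ge> 2" by simp
  have AAlen: "\<forall>A'\<in>set AA. length A' = p - 1" using A As by (simp add: AA_def)
  have distAA: "distinct (concat AA)" and VAA: "set (concat AA) \<subseteq> V"
    using dist by (auto simp: AA_def V_def)
  have lenAA: "length AA = D" by (simp add: AA_def D_def)

  define colour where "colour v = (LEAST k. k < D \<and> v \<in> set (AA ! k))" for v
  have colour: "colour v < D" "v \<in> set (AA ! colour v)" if "v \<in> set (concat AA)" for v
  proof -
    have "\<exists>k. k < D \<and> v \<in> set (AA ! k)"
      using that lenAA by (auto simp: in_set_conv_nth[of _ AA])
    from LeastI_ex[OF this] show "colour v < D" "v \<in> set (AA ! colour v)"
      unfolding colour_def by auto
  qed
  have colour_eq: "colour v = k" if "k < D" "v \<in> set (AA ! k)" for v k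
  proof -
    have "v \<in> set (concat AA)" using that lenAA nth_mem[of k AA] by auto
    then show ?thesis using distinct_concat_nth_inj[OF distAA] colour that lenAA by metis
  qed

  have cell: "length s = N" "distinct (map snd s)" "snd ` set s = set (concat AA)" "fst ` set s \<subseteq> {..<p}"
    if "s \<in> cells AA R" for s
  proof -
    have m: "mset (map snd s) = mset (concat AA)" by (rule cells_snd[OF that])
    show "length s = N" using mset_eq_length[OF m] length_concat_const[OF AAlen] lenAA by (simp add: N_def)
    show "distinct (map snd s)" using mset_eq_imp_distinct_iff[OF m] distAA by simp
    show "snd ` set s = set (concat AA)" using mset_eq_setD[OF m] by simp
    show "fst ` set s \<subseteq> {..<p}" using cells_fst[OF that] by (auto simp: R_def)
  qed
  have cellsub: "set s \<subseteq> {..<p} \<times> V" if "s \<in> cells AA R" for s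
    using cell(3,4)[OF that] VAA by force
  have scell: "length s = N" "set s \<subseteq> {..<p} \<times> V"
    "\<And>n. n < length s \<Longrightarrow> fst (s ! n) = n mod (p - 1) + 1 \<and> colour (snd (s ! n)) = n div (p - 1)"
    if "s \<in> sorted_cells AA [1..<p]" for s
  proof -
    have m: "p - 1 > 0" "length [1..<p] = p - 1" using p2 by auto
    show len: "length s = N"
      using sorted_cells_nth(1)[OF AAlen m that] lenAA by (simp add: N_def)
    have nth: "fst (s ! n) = n mod (p - 1) + 1" "snd (s ! n) \<in> set (AA ! (n div (p - 1)))" "n div (p - 1) < D"
      if n: "n < length s" for n
    proof -
      have "n mod (p - 1) < p - 1" using m(1) by simp
      then show "fst (s ! n) = n mod (p - 1) + 1" "snd (s ! n) \<in> set (AA ! (n div (p - 1)))"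
        using sorted_cells_nth(2)[OF AAlen m \<open>s \<in> sorted_cells AA [1..<p]\<close> n] by auto
      show "n div (p - 1) < D" using n len by (simp add: N_def less_mult_imp_div_less mult.commute)
    qed
    show "fst (s ! n) = n mod (p - 1) + 1 \<and> colour (snd (s ! n)) = n div (p - 1)" if "n < length s" for n
      using nth[OF that] colour_eq by blast
    show "set s \<subseteq> {..<p} \<times> V"
    proof
      fix z assume "z \<in> set s"
      then obtain n where n: "n < length s" "z = s ! n" by (metis in_set_conv_nth)
      have "n mod (p - 1) + 1 < p" using m(1) mod_less_divisor[of "p - 1" n] by linarith
      moreover have "AA ! (n div (p - 1)) \<in> set AA" using nth(3)[OF n(1)] lenAA by (intro nth_mem) simp
      then have "snd z \<in> set (concat AA)" unfolding set_concat n(2) using nth(2)[OF n(1)] by blast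
      then have "snd z \<in> V" using VAA by blast
      ultimately show "z \<in> {..<p} \<times> V" using nth(1)[OF n(1)] n(2) by (metis lessThan_iff mem_Times_iff)
    qed
  qed
  \<comment> \<open>The cells of the filling: the distinguished color has \<open>p\<close> rooks on
    the enlarged board, one vertex more than in a cell of the cycle.\<close>
  define TT where "TT = {s @ t | s t. length s = p \<and> distinct (map fst s) \<and> distinct (map snd s) \<and>
    set s \<subseteq> {..<p} \<times> set (A @ B) \<and> t \<in> cells As R}"
  have TT: "length u = Suc N" "distinct (map snd u)" "set u \<subseteq> {..<p} \<times> V" if uT: "u \<in> TT" for u
  proof -
    obtain s t where u: "u = s @ t" and s: "length s = p" "distinct (map snd s)"
      "set s \<subseteq> {..<p} \<times> set (A @ B)" and t: "t \<in> cells As R"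
      using uT unfolding TT_def by auto
    have m: "mset (map snd t) = mset (concat As)" by (rule cells_snd[OF t])
    show "length u = Suc N"
      using mset_eq_length[OF m] length_concat_const[OF As] u s(1) p2 by (simp add: N_def D_def)
    have t': "snd ` set t = set (concat As)" using mset_eq_setD[OF m] by simp
    have disj: "set (A @ B) \<inter> set (concat As) = {}"
      using dist by (simp only: distinct_append set_append) blast
    have "snd ` set s \<subseteq> set (A @ B)" "distinct (concat As)" using s(3) dist by auto
    then show "distinct (map snd u)"
      unfolding u using distinct_snd_append_cells[OF s(2) _ t _ disj] by blast
    have "fst ` set t \<subseteq> {..<p}" using cells_fst[OF t] by (auto simp: R_def)
    moreover have "snd ` set t \<subseteq> V" unfolding t' V_def set_append by blast
    ultimately have "set t \<subseteq> {..<p} \<times> V" unfolding subset_iff image_subset_iff mem_Times_iff by blast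
    moreover have "set s \<subseteq> {..<p} \<times> V" using s(3) unfolding V_def set_append by blast
    ultimately show "set u \<subseteq> {..<p} \<times> V" unfolding u by simp
  qed

  \<comment> \<open>The apex is minus the all-ones vector, so before perturbation the coned cochain
    tests cells against the ray through the all-ones vector.\<close>
  define c0 where "c0 = case_label (\<lambda>v. tens p 0 (x v))
     (\<lambda>v. tens p 0 (\<lambda>k. if k = colour v then 1 else 0)) (tens p 0 (\<lambda>_. 1))"
  have real0: "realize p c0 (0, Apex) = tens p 0 (\<lambda>_. 1)"
    "i < p \<Longrightarrow> realize p c0 (i, Init v) = tens p i (x v)"
    "i < p \<Longrightarrow> realize p c0 (i, Ref v) = tens p i (\<lambda>k. if k = colour v then 1 else 0)" for i v
    using p2 by (simp_all add: realize_def c0_def act_tens_0 act_0)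
  define Lab where "Lab = {..<p} \<times> (Init ` V \<union> Ref ` V \<union> {Apex})"
  \<comment> \<open>Distinctness concerns labels: translates of one label move together and cannot
    be placed independently.\<close>
  define LL where "LL = {L. set L \<subseteq> Lab \<and> length L = N \<and> distinct (map snd L)}"
  have "finite Lab" by (simp add: Lab_def V_def)
  then have "finite LL"
    unfolding LL_def by (rule finite_subset[rotated, OF finite_lists_length_eq[of Lab N]]) auto
  have "\<exists>cs. (\<forall>z r. (\<lambda>n. cs n z r) \<longlonglongrightarrow> c0 z r) \<and> (\<forall>n. \<forall>f\<in>(\<lambda>L c. vol (map (realize p c) L)) ` LL. f (cs n) \<noteq> 0)"
  proof (rule generic_sequence)
    fix f assume "f \<in> (\<lambda>L c. vol (map (realize p c) L)) ` LL"
    then obtain L where L: "L \<in> LL" "f = (\<lambda>c. vol (map (realize p c) L))" by blast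
    show "\<exists>c. f c \<noteq> 0"
      unfolding L(2) using L(1) p2 by (intro ex_realize_vol_nonzero) (auto simp: LL_def Lab_def)
    show "\<exists>q. \<forall>t. f (\<lambda>x r. c x r + t * (c' x r - c x r)) = poly q t" for c c'
      unfolding L(2) by (rule realize_vol_line_poly)
  qed (use \<open>finite LL\<close> in simp)
  then obtain cs where cs: "\<forall>z r. (\<lambda>n. cs n z r) \<longlonglongrightarrow> c0 z r"
    "\<forall>n. \<forall>f\<in>(\<lambda>L c. vol (map (realize p c) L)) ` LL. f (cs n) \<noteq> 0"
    by (elim exE conjE)
  have lim0: "(\<lambda>n. cs n z r) \<longlonglongrightarrow> c0 z r" for z r using cs(1) by (elim allE)
  have gen: "vol (map (realize p (cs n)) L) \<noteq> 0" if "L \<in> LL" for n L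
    using bspec[OF spec[OF cs(2)] imageI[OF that]] .
  have lim: "(\<lambda>n. realize p (cs n) z r) \<longlonglongrightarrow> realize p c0 z r" for z r
    unfolding realize_def case_prod_beta by (intro tendsto_act lim0)

  define F G :: "nat \<times> 'v \<Rightarrow> nat \<times> 'v label" where "F = map_prod id Init" and "G = map_prod id Ref"
  let ?q = "(0, Apex) :: nat \<times> 'v label"
  have mapF: "map (realize p c0) (map F u) = map (\<lambda>(i, v). tens p i (x v)) u"
    if "set u \<subseteq> {..<p} \<times> V" for u
    using that by (auto simp: F_def real0)
  have mapG: "map (realize p c0) (?q # map G u)
     = tens p 0 (\<lambda>_. 1) # map (\<lambda>(i, v). tens p i (\<lambda>k. if k = colour v then 1 else 0)) u"
    if "set u \<subseteq> {..<p} \<times> V" for u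
    using that by (auto simp: G_def real0)
  have fin: "finite {u. set u \<subseteq> {..<p} \<times> V \<and> length u = m}" for m
    by (rule finite_lists_length_eq) (simp add: V_def)
  have "finite TT" by (rule finite_subset[OF _ fin[of "Suc N"]]) (use TT in auto)
  then have ev1: "\<forall>\<^sub>F n in sequentially. \<forall>u\<in>TT. orient (map (realize p (cs n)) (map F u)) = 0"
  proof (rule eventually_ball_finite, intro ballI)
    fix u assume u: "u \<in> TT"
    have "\<not> zero_in_hull N (map (realize p c0) (map F u))"
      using no u unfolding mapF[OF TT(3)[OF u]] by (auto simp: TT_def N_def D_def R_def)
    then show "\<forall>\<^sub>F n in sequentially. orient (map (realize p (cs n)) (map F u)) = 0"
      using TT(1)[OF u] by (intro eventually_orient_zero[OF _ _ lim]) auto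
  qed
  let ?C0 = "{s \<in> cells AA R. 0 \<in> fst ` set s}"
  have "finite ?C0" by (rule finite_subset[OF _ fin[of N]]) (use cell(1) cellsub in auto)
  then have ev2: "\<forall>\<^sub>F n in sequentially. \<forall>s\<in>?C0. orient (map (realize p (cs n)) (?q # map G s)) = 0"
  proof (rule eventually_ball_finite, intro ballI)
    fix s assume s: "s \<in> ?C0"
    then have sc: "s \<in> cells AA R" by simp
    have "\<not> zero_in_hull ((p - 1) * D) (map (realize p c0) (?q # map G s))"
      unfolding mapG[OF cellsub[OF sc]]
    proof (rule ref_not_zero_in_hull[OF p2])
      show "i < p \<and> colour v < D" if "(i, v) \<in> set s" for i v
        using that cell(3,4)[OF sc] colour(1) by force
      show "0 \<in> fst ` set s" using s by simp
      fix k assume k: "k < D"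
      \<comment> \<open>A color has only \<open>p - 1\<close> columns in a cell, so its vertices
        cannot meet all \<open>p\<close> rows.\<close>
      let ?S = "{z \<in> set s. colour (snd z) = k}"
      have "snd ` ?S \<subseteq> set (AA ! k)" using cell(3)[OF sc] colour(2) by auto
      moreover have "inj_on snd ?S"
        using cell(2)[OF sc] by (auto simp: distinct_map intro: inj_on_subset)
      ultimately have "card ?S \<le> card (set (AA ! k))"
        by (intro card_inj_on_le[of snd]) auto
      also have "\<dots> \<le> p - 1"
        using card_length[of "AA ! k"] AAlen k lenAA by auto
      finally have "card (fst ` ?S) < card {..<p}"
        using card_image_le[of ?S fst] p2 by simp
      then have "\<not> {..<p} \<subseteq> fst ` ?S" using card_mono[of "fst ` ?S" "{..<p}"] by auto
      then obtain i where "i < p" "i \<notin> fst ` ?S" by auto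
      then show "\<exists>i<p. \<forall>v. (i, v) \<in> set s \<longrightarrow> colour v \<noteq> k"
        by (intro exI[of _ i]) (force)
    qed
    then show "\<forall>\<^sub>F n in sequentially. orient (map (realize p (cs n)) (?q # map G s)) = 0"
      using cell(1)[OF sc] by (intro eventually_orient_zero[OF _ _ lim]) (auto simp: N_def)
  qed
  let ?C1 = "sorted_cells AA [1..<p]"
  have "finite ?C1" by (rule finite_subset[OF _ fin[of N]]) (use scell in auto)
  then have ev3: "\<forall>\<^sub>F n in sequentially. \<forall>s\<in>?C1. orient (map (realize p (cs n)) (?q # map G s)) = 1"
  proof (rule eventually_ball_finite, intro ballI)
    fix s assume s: "s \<in> ?C1"
    have "cof (map (realize p c0) (?q # map G s)) i > 0" if "i < Suc N" for i
      unfolding mapG[OF scell(2)[OF s]]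
      using scell(1,3)[OF s] that p2 by (intro ref_sorted_cof) (auto simp: N_def)
    then show "\<forall>\<^sub>F n in sequentially. orient (map (realize p (cs n)) (?q # map G s)) = 1"
      using scell(1)[OF s] by (intro eventually_orient_one[OF _ _ lim]) auto
  qed
  obtain n where ev: "\<forall>u\<in>TT. orient (map (realize p (cs n)) (map F u)) = 0"
    "\<forall>s\<in>?C0. orient (map (realize p (cs n)) (?q # map G s)) = 0"
    "\<forall>s\<in>?C1. orient (map (realize p (cs n)) (?q # map G s)) = 1"
    using eventually_happens'[OF sequentially_bot eventually_conj[OF ev1 eventually_conj[OF ev2 ev3]]]
    by (elim exE conjE)
  note n = bspec[OF ev(1)] bspec[OF ev(2)] bspec[OF ev(3)]

  define h where "h L = orient (map (realize p (cs n)) L)" for L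
  have cocycle: "bd L h = 0" if L: "set L \<subseteq> Lab" "length L = Suc (Suc N)" "distinct (map snd L)" for L
  proof -
    have "bd (map (realize p (cs n)) L) orient = 0"
    proof (rule orient_cocycle)
      fix i j assume ij: "i < j" "j < Suc (Suc N)"
      have "set (omit i (omit j L)) \<subseteq> Lab" using set_omit_subset L(1) by (meson subset_trans)
      moreover have "distinct (map snd (omit i (omit j L)))"
        using distinct_omit L(3) by (metis map_omit)
      moreover have "length (omit i (omit j L)) = N" using ij L(2) by (simp add: length_omit)
      ultimately have "omit i (omit j L) \<in> LL" by (simp add: LL_def)
      then show "vol (omit i (omit j (map (realize p (cs n)) L))) \<noteq> 0"
        using gen by (metis map_omit)
    qed (use L in simp)
    then show ?thesis by (simp add: bd_map h_def[abs_def])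
  qed
  have alt_apex: "alternating (\<lambda>s. h (?q # map H s))" for H :: "nat \<times> 'v \<Rightarrow> nat \<times> 'v label"
    unfolding alternating_def h_def
  proof (intro allI)
    fix xs :: "(nat \<times> 'v) list" and a b ys
    show "orient (map (realize p (cs n)) (?q # map H (xs @ a # b # ys)))
       = - orient (map (realize p (cs n)) (?q # map H (xs @ b # a # ys)))"
      using orient_swap[of "map (realize p (cs n)) (?q # map H xs)" "realize p (cs n) (H a)"
        "realize p (cs n) (H b)" "map (realize p (cs n)) (map H ys)"] by simp
  qed
  have FLab: "set (map F u) \<subseteq> Lab" and GLab: "set (map G u) \<subseteq> Lab" if "set u \<subseteq> {..<p} \<times> V" for u
    using that by (auto simp: F_def G_def Lab_def)
  have qLab: "?q \<in> Lab" using p2 by (simp add: Lab_def)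
  have sndF: "map snd (map F u) = map Init (map snd u)" and sndG: "map snd (map G u) = map Ref (map snd u)" for u
    by (auto simp: F_def G_def)
  have injI: "inj_on Init X" "inj_on Ref X" for X :: "'v set" by (auto simp: inj_on_def)
  have lenR: "length R = p" "distinct R" "length R = Suc (length A')" if "A' \<in> set AA" for A'
    using p2 AAlen that by (auto simp: R_def)

  have "chess (A # As) R (\<lambda>s. h (?q # map F s)) = 0"
  proof (rule chess_fill[OF alt_apex])
    show "length R = Suc (length A)" "length R \<le> length B" "distinct R" "distinct (A @ B)"
      "\<forall>A\<in>set As. length R = Suc (length A)"
      using A As B dist p2 by (auto simp: R_def)
    fix s t assume st: "length s = length R" "distinct (map fst s)" "distinct (map snd s)"
      "set s \<subseteq> set R \<times> set (A @ B)" "t \<in> cells As R"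
    let ?u = "s @ t"
    have u: "?u \<in> TT" using st by (auto simp: TT_def R_def atLeast0LessThan)
    \<comment> \<open>The boundary of the cone is its base minus the cone over the boundary, and
      \<open>h\<close> vanishes on the base because 0 is in no hull of the filling.\<close>
    have "bd (?q # map F ?u) h = 0"
    proof (rule cocycle)
      show "set (?q # map F ?u) \<subseteq> Lab" using FLab[OF TT(3)[OF u]] qLab by simp
      show "length (?q # map F ?u) = Suc (Suc N)" using TT(1)[OF u] by simp
      have "distinct (map snd (map F ?u))"
        unfolding sndF using TT(2)[OF u] injI by (simp only: distinct_map)
      moreover have "Apex \<notin> set (map snd (map F ?u))" unfolding sndF by auto
      ultimately show "distinct (map snd (?q # map F ?u))" by simp
    qed
    moreover have "h (map F ?u) = 0" unfolding h_def by (rule n(1)[OF u])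
    ultimately have "bd (map F ?u) (\<lambda>t. h (?q # t)) = 0" by simp
    then show "bd ?u (\<lambda>s. h (?q # map F s)) = 0" by (simp only: bd_map)
  qed
  then have valF: "chess AA R (\<lambda>s. h (?q # map F s)) = 0" by (simp only: AA_def)

  have R0: "R = 0 # [1..<p]" using p2 by (simp add: R_def upt_conv_Cons)
  have valG: "chess AA R (\<lambda>s. h (?q # map G s)) = fact (p - 1) ^ D"
  proof -
    have "chess AA (0 # [1..<p]) (\<lambda>s. h (?q # map G s)) = fact (length [1..<p]) ^ length AA * 1"
    proof (rule chess_sorted[OF alt_apex])
      show "even (length [1..<p])" using \<open>odd p\<close> by simp
      show "\<forall>A\<in>set AA. length A = length [1..<p]" using AAlen by simp
      show "h (?q # map G s) = 0" if "s \<in> cells AA (0 # [1..<p])" "0 \<in> fst ` set s" for s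
        using n(2)[of s] that by (simp add: h_def R0)
      show "h (?q # map G s) = 1" if "s \<in> sorted_cells AA [1..<p]" for s
        using n(3)[OF that] by (simp only: h_def)
    qed
    then show ?thesis unfolding R0 using lenAA by simp
  qed

  have prismL: "set L \<subseteq> Lab" "length L = Suc N" "distinct (map snd L)" "Apex \<notin> snd ` set L"
    if s: "s \<in> cells AA R" and k: "k < length s" and L: "L = map F (take (Suc k) s) @ map G (drop k s)" for s k L
  proof -
    have "set (take (Suc k) s) \<subseteq> {..<p} \<times> V" "set (drop k s) \<subseteq> {..<p} \<times> V"
      using cellsub[OF s] set_take_subset set_drop_subset by fast+
    then show "set L \<subseteq> Lab" unfolding L set_append by (simp only: FLab GLab Un_subset_iff simp_thms)
    show "length L = Suc N" using k cell(1)[OF s] by (simp add: L)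
    have msnd: "map snd L = map Init (take (Suc k) (map snd s)) @ map Ref (drop k (map snd s))"
      unfolding L map_append sndF sndG by (simp add: take_map drop_map)
    show "distinct (map snd L)"
    proof -
      have "distinct (map Init (take (Suc k) (map snd s)))" "distinct (map Ref (drop k (map snd s)))"
        using distinct_take[OF cell(2)[OF s]] distinct_drop[OF cell(2)[OF s]] injI
        by (simp_all only: distinct_map simp_thms)
      then show ?thesis unfolding msnd by auto
    qed
    have "Apex \<notin> set (map snd L)" unfolding msnd by auto
    then show "Apex \<notin> snd ` set L" by simp
  qed
  have "chess AA R (\<lambda>s. h (?q # map G s)) - chess AA R (\<lambda>s. h (?q # map F s))
     = chess AA R (\<lambda>s. h (?q # map G s) - h (?q # map F s))"
    by (rule chess_diff[symmetric])
  also have "\<dots> = chess AA R (\<lambda>s. prism F G s h + bd s (\<lambda>s. prism F G s (\<lambda>u. h (?q # u))))"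
  proof (rule chess_cong)
    fix s assume s: "s \<in> cells AA R"
    \<comment> \<open>The cocycle property removes the apex, which the cyclic action would move, and
      leaves the invariant cochain \<open>h\<close>.\<close>
    have "prism F G s (\<lambda>t. bd t (\<lambda>u. h (?q # u))) = prism F G s h"
    proof (rule prism_cong)
      fix k assume "k < length s"
      let ?L = "map F (take (Suc k) s) @ map G (drop k s)"
      note L = prismL[OF s \<open>k < length s\<close> refl]
      have "bd (?q # ?L) h = 0" by (rule cocycle) (use L qLab in auto)
      then show "bd ?L (\<lambda>u. h (?q # u)) = h ?L" by simp
    qed
    then show "h (?q # map G s) - h (?q # map F s) = prism F G s h + bd s (\<lambda>s. prism F G s (\<lambda>u. h (?q # u)))"
      using prism_homotopy[of "\<lambda>u. h (?q # u)" G s F] by simp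
  qed
  also have "\<dots> = chess AA R (\<lambda>s. prism F G s h)"
    using lenR(3) by (simp add: chess_add chess_bd_cycle)
  finally have val: "fact (p - 1) ^ D = chess AA R (\<lambda>s. prism F G s h)"
    using valF valG by simp
  have "int p dvd chess AA [0..<p] (\<lambda>s. prism F G s h)"
  proof (rule chess_invariant_dvd)
    show "AA \<noteq> []" by (simp add: AA_def)
    fix s assume s: "s \<in> cells AA [0..<p]"
    let ?g = "map_prod (\<lambda>i. Suc i mod p) id :: nat \<times> 'v label \<Rightarrow> nat \<times> 'v label"
    have "prism F G (map (map_prod (\<lambda>i. Suc i mod p) id) s) h = prism F G s (\<lambda>t. h (map ?g t))"
      by (rule prism_map) (auto simp: F_def G_def)
    also have "\<dots> = prism F G s h"
    proof (rule prism_cong)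
      fix k assume "k < length s"
      let ?L = "map F (take (Suc k) s) @ map G (drop k s)"
      have "length ?L = Suc N" using prismL(2)[OF _ \<open>k < length s\<close> refl] s by (simp add: R_def)
      moreover have "realize p (cs n) (?g z) = act p 1 (realize p (cs n) z)" for z
        using p2 by (cases z) (simp add: realize_def act_mod act_act)
      then have "map (realize p (cs n)) (map ?g ?L) = map (act p 1) (map (realize p (cs n)) ?L)"
        by (simp only: map_map comp_def)
      ultimately show "h (map ?g ?L) = h ?L"
        unfolding h_def using orient_act[OF p2 \<open>odd p\<close>, of "map (realize p (cs n)) ?L" D]
        by (simp only: length_map N_def)
    qed
    finally show "prism F G (map (map_prod (\<lambda>i. Suc i mod p) id) s) h = prism F G s h" .
  qed (use AAlen p p2 in auto)
  then have "int p dvd fact (p - 1) ^ D" using val by (simp add: R_def)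
  moreover have "(fact (p - 1) :: int) ^ D = int (fact (p - 1) ^ D)" by simp
  ultimately have "p dvd fact (p - 1) ^ D" by (simp only: int_dvd_int_iff)
  then have "p dvd fact (p - 1)" using p(1) prime_dvd_power_nat by blast
  then show False using p(1) p2 by (simp add: prime_dvd_fact_iff)
qed

section \<open>Colored Tverberg partitions\<close>

text \<open>Induction on the size of the support: one vertex \<open>v\<close> is split off and the
  remaining coordinates are rescaled by \<open>1 - x v\<close>.\<close>

lemma affine_map_on_simplex_eq_sum:
  fixes f :: "(nat \<Rightarrow> real) \<Rightarrow> real ^ 'd"
  assumes f: "affine_map_on_simplex n f" and "n > 0" and x: "x \<in> standard_simplex (n - 1)"
  shows "f x = (\<Sum>v<n. x v *\<^sub>R f (\<lambda>i. if i = v then 1 else 0))"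
proof -
  have set: "{..n - Suc 0} = {..<n}" using \<open>n > 0\<close> by auto
  show ?thesis
    using x
  proof (induction "card {v. x v \<noteq> 0}" arbitrary: x rule: less_induct)
    case less
    note x = less.prems
    have nn: "0 \<le> x i" and le1: "x i \<le> 1" and out: "i \<ge> n \<Longrightarrow> x i = 0" for i
      using x \<open>n > 0\<close> by (auto simp: standard_simplex_def)
    have sum1: "(\<Sum>i<n. x i) = 1" using x by (simp add: standard_simplex_def set)
    have fin: "finite {v. x v \<noteq> 0}"
    proof (rule finite_subset)
      show "{v. x v \<noteq> 0} \<subseteq> {..<n}"
      proof
        fix v assume "v \<in> {v. x v \<noteq> 0}"
        then show "v \<in> {..<n}" using out[of v] by (cases "v < n") auto
      qed
    qed simp
    obtain v where v: "v < n" "x v \<noteq> 0" using sum1 by (metis lessThan_iff sum.neutral zero_neq_one)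
    let ?e = "\<lambda>v i. if i = v then 1 else 0 :: real"
    show ?case
    proof (cases "x v = 1")
      case True
      have "(\<Sum>i\<in>{..<n} - {v}. x i) = 0" using sum1 True v by (simp add: sum_diff1)
      then have z: "x i = 0" if "i \<noteq> v" for i
        using that nn out by (cases "i < n") (auto simp: sum_nonneg_eq_0_iff)
      then have "x = ?e v" using True by auto
      moreover have "(\<Sum>i<n. ?e v i *\<^sub>R f (?e i)) = f (?e v)"
        using v(1) by (simp add: if_distrib[of "\<lambda>a. a *\<^sub>R _"] sum.delta cong: if_cong)
      ultimately show ?thesis by simp
    next
      case False
      then have t: "0 < 1 - x v" using le1[of v] by simp
      define y where "y i = (if i = v then 0 else x i / (1 - x v))" for i
      have rest: "(\<Sum>i\<in>{..<n} - {v}. x i) = 1 - x v" using sum1 v by (simp add: sum_diff1)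
      have ysum: "(\<Sum>i<n. y i) = 1"
      proof -
        have "(\<Sum>i<n. y i) = y v + (\<Sum>i\<in>{..<n} - {v}. y i)" using v by (intro sum.remove) auto
        also have "\<dots> = (\<Sum>i\<in>{..<n} - {v}. x i / (1 - x v))" by (auto simp: y_def intro: sum.cong)
        also have "\<dots> = 1" using rest t by (simp flip: sum_divide_distrib)
        finally show ?thesis .
      qed
      have y0: "y i \<ge> 0" for i using nn t by (simp add: y_def)
      have yout: "i \<ge> n \<Longrightarrow> y i = 0" for i using out by (simp add: y_def)
      have "y i \<le> 1" for i
        using member_le_sum[of i "{..<n}" y] y0 ysum yout[of i] by (cases "i < n") auto
      then have y: "y \<in> standard_simplex (n - 1)"
        using y0 yout ysum \<open>n > 0\<close> by (auto simp: standard_simplex_def set)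
      have "{i. y i \<noteq> 0} \<subset> {v. x v \<noteq> 0}" using v(2) by (auto simp: y_def)
      then have "card {i. y i \<noteq> 0} < card {v. x v \<noteq> 0}" by (rule psubset_card_mono[OF fin])
      then have fy: "f y = (\<Sum>i<n. y i *\<^sub>R f (?e i))" using less.hyps y by blast
      have xy: "x = (\<lambda>i. (1 - x v) * y i + x v * ?e v i)" using t by (auto simp: y_def)
      have xi: "(1 - x v) * y i + x v * ?e v i = x i" for i using t by (auto simp: y_def)
      have "?e v \<in> standard_simplex (n - 1)" using v(1) by (simp add: basis_in_standard_simplex)
      then have "f x = (1 - x v) *\<^sub>R f y + x v *\<^sub>R f (?e v)"
        using f y nn le1 unfolding affine_map_on_simplex_def by (subst xy) auto
      also have "\<dots> = (\<Sum>i<n. ((1 - x v) * y i) *\<^sub>R f (?e i)) + (\<Sum>i<n. (x v * ?e v i) *\<^sub>R f (?e i))"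
        using v(1) by (simp add: fy scaleR_sum_right if_distrib[of "\<lambda>a. _ * a"]
          if_distrib[of "\<lambda>a. a *\<^sub>R _"] sum.delta cong: if_cong)
      also have "\<dots> = (\<Sum>i<n. x i *\<^sub>R f (?e i))"
        by (simp only: sum.distrib[symmetric] scaleR_left_distrib[symmetric] xi)
      finally show ?thesis .
    qed
  qed
qed

text \<open>Rows are distinct within a block and blocks have disjoint columns. This makes the faces
  rainbow in the colors other than the split one.\<close>

lemma cells_block_unique:
  assumes "t \<in> cells As R" "distinct R" "distinct (concat As)" "A \<in> set As"
    "(i, v) \<in> set t" "(i, v') \<in> set t" "v \<in> set A" "v' \<in> set A"
  shows "v = v'"
  using assms
proof (induction As arbitrary: t)
  case (Cons A0 As)
  then obtain s1 t1 where t: "t = s1 @ t1" "s1 \<in> placements A0 R" "t1 \<in> cells As R" by auto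
  have s1: "distinct (map fst s1)" using distinct_fst_placements(1)[OF t(2) Cons.prems(2)] .
  have "mset (map snd s1) = mset A0" using t(2) by (simp add: placements_def)
  then have snd1: "snd ` set s1 = set A0" by (metis list.set_map mset_eq_setD)
  have snd2: "snd ` set t1 = set (concat As)"
    using mset_eq_setD[OF cells_snd[OF t(3)]] by simp
  have disj: "set A0 \<inter> set (concat As) = {}" using Cons.prems(3) by simp
  show ?case
  proof (cases "A = A0")
    case True
    then have "v \<notin> snd ` set t1" "v' \<notin> snd ` set t1" using Cons.prems(7,8) disj snd2 by auto
    then have "(i, v) \<in> set s1" "(i, v') \<in> set s1"
      using Cons.prems(5,6) t(1) by (auto simp: image_iff)
    then show ?thesis using s1 by (metis eq_key_imp_eq_value)
  next
    case False
    then have A: "A \<in> set As" using Cons.prems(4) by simp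
    then have "set A \<subseteq> set (concat As)" by auto
    then have "v \<notin> snd ` set s1" "v' \<notin> snd ` set s1"
      using Cons.prems(7,8) disj unfolding snd1 by blast+
    then have "(i, v) \<in> set t1" "(i, v') \<in> set t1"
      using Cons.prems(5,6) t(1) by (auto simp: image_iff)
    then show ?thesis
      using Cons.IH[OF t(3) Cons.prems(2) _ A _ _ Cons.prems(7,8)] Cons.prems(3) by simp
  qed
qed simp

lemma coloring_blocks:
  assumes "vertex_coloring n k C" "\<forall>i\<in>{1..k}. m < card (C i)" "n > k * (2 * m)"
  obtains i0 ks where "i0 \<in> {1..k}" "distinct (i0 # ks)" "set (i0 # ks) = {1..k}" "2 * m < card (C i0)"
proof -
  have fin: "finite (C i)" if "i \<in> {1..k}" for i
  proof (rule finite_subset)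
    have "C i \<subseteq> (\<Union>i\<in>{1..k}. C i)" using that by (rule UN_upper)
    also have "\<dots> = {..<n}" using assms(1) by (simp only: vertex_coloring_def)
    finally show "C i \<subseteq> {..<n}" .
  qed simp
  have "n = (\<Sum>i\<in>{1..k}. card (C i))"
  proof -
    have "card (\<Union>i\<in>{1..k}. C i) = (\<Sum>i\<in>{1..k}. card (C i))"
      using assms(1) fin unfolding vertex_coloring_def disjoint_family_on_def
      by (intro card_UN_disjoint) auto
    then show ?thesis using assms(1) by (simp add: vertex_coloring_def)
  qed
  then have n: "(\<Sum>i\<in>{1..k}. card (C i)) > k * (2 * m)" using assms(3) by simp
  have "\<exists>i0\<in>{1..k}. 2 * m < card (C i0)"
  proof (rule ccontr)
    assume "\<not> (\<exists>i0\<in>{1..k}. 2 * m < card (C i0))"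
    then have "(\<Sum>i\<in>{1..k}. card (C i)) \<le> (\<Sum>i\<in>{1..k}. 2 * m)"
      by (intro sum_mono) (simp add: not_less)
    then show False using n by simp
  qed
  then obtain i0 where i0: "i0 \<in> {1..k}" "2 * m < card (C i0)" by blast
  let ?ks = "sorted_list_of_set ({1..k} - {i0})"
  have "distinct (i0 # ?ks)" "set (i0 # ?ks) = {1..k}" using i0(1) by auto
  with i0 show ?thesis using that by blast
qed

lemma colored_tverberg_property_prime:
  assumes "prime p" "odd p" and n: "n > (CARD('d) + 1) * (2 * (p - 1))"
  shows "colored_tverberg_property TYPE('d::finite) p n"
  unfolding colored_tverberg_property_def
proof (intro allI impI)
  fix f :: "(nat \<Rightarrow> real) \<Rightarrow> real ^ 'd" and C
  let ?d = "CARD('d)"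
  assume f: "affine_map_on_simplex n f" and C: "vertex_coloring n (?d + 1) C"
    and cC: "\<forall>i\<in>{1..?d + 1}. p \<le> card (C i)"
  have p2: "p \<ge> 2" using assms(1) by (rule prime_ge_2_nat)
  have n0: "n > 0" using n by simp
  have "\<forall>i\<in>{1..?d + 1}. p - 1 < card (C i)" using cC p2 by fastforce
  from coloring_blocks[OF C this n] obtain i0 ks where i0: "i0 \<in> {1..?d + 1}"
    and ks: "distinct (i0 # ks)" "set (i0 # ks) = {1..?d + 1}" and big: "2 * (p - 1) < card (C i0)" .
  have Cfin: "finite (C i)" and Csub: "C i \<subseteq> {..<n}" if "i \<in> {1..?d + 1}" for i
    using C that unfolding vertex_coloring_def by (blast intro: finite_subset[OF _ finite_lessThan])+
  have Cdisj: "C i \<inter> C j = {}" if "i \<in> {1..?d + 1}" "j \<in> {1..?d + 1}" "i \<noteq> j" for i j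
    using C that unfolding vertex_coloring_def disjoint_family_on_def by blast
  define el where "el i = sorted_list_of_set (C i)" for i
  have el: "set (el i) = C i" "distinct (el i)" "length (el i) = card (C i)" if "i \<in> {1..?d + 1}" for i
    using Cfin[OF that] by (simp_all add: el_def)
  define A B where "A = take (p - 1) (el i0)" and "B = drop (p - 1) (el i0)"
  define As where "As = map (\<lambda>i. take (p - 1) (el i)) ks"
  have ksin: "i \<in> {1..?d + 1}" "i \<noteq> i0" if "i \<in> set ks" for i using ks that by auto
  have AB: "A @ B = el i0" by (simp add: A_def B_def)
  have Asub: "set (take (p - 1) (el i)) \<subseteq> C i" if "i \<in> {1..?d + 1}" for i
    using set_take_subset el(1)[OF that] by fast
  have lenAs: "length As = ?d"
  proof -
    have "length (i0 # ks) = ?d + 1" using distinct_card[OF ks(1)] ks(2) by simp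
    then show ?thesis by (simp add: As_def)
  qed
  have concatAs: "set (concat As) \<subseteq> (\<Union>i\<in>set ks. C i)"
    using Asub ksin by (fastforce simp: As_def)
  have distAs: "distinct (concat As)"
  proof -
    have "distinct (concat (map (\<lambda>i. take (p - 1) (el i)) zs))" if "distinct zs" "set zs \<subseteq> {1..?d + 1}" for zs
      using that
    proof (induction zs)
      case (Cons i zs)
      have "set (take (p - 1) (el i)) \<inter> set (take (p - 1) (el j)) = {}" if "j \<in> set zs" for j
      proof -
        have ij: "i \<in> {1..?d + 1}" "j \<in> {1..?d + 1}" "i \<noteq> j" using Cons.prems that by auto
        then show ?thesis using Asub[OF ij(1)] Asub[OF ij(2)] Cdisj[OF ij] by blast
      qed
      moreover have "distinct (concat (map (\<lambda>i. take (p - 1) (el i)) zs))"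
        using Cons.prems by (intro Cons.IH) auto
      moreover have "distinct (take (p - 1) (el i))" using Cons.prems el(2)[of i] by simp
      ultimately show ?case by (simp only: list.map concat.simps distinct_append set_concat set_map) blast
    qed simp
    then show ?thesis unfolding As_def using ks by auto
  qed
  have disjA: "C i0 \<inter> set (concat As) = {}"
    using concatAs Cdisj[OF i0] ksin by blast
  have dist: "distinct (A @ B @ concat As)"
    unfolding append_assoc[symmetric] AB using el(1,2)[OF i0] distAs disjA by (simp del: set_concat)

  obtain h where h: "bij_betw h {0..<?d} (UNIV :: 'd set)"
    using ex_bij_betw_nat_finite[OF finite[of "UNIV :: 'd set"]] by (elim exE)
  define e where "e v = (\<lambda>i. if i = v then 1 else 0 :: real)" for v :: nat
  define x where "x v k = (if k < ?d then vec_nth (f (e v)) (h k) else 1)" for v k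

  have "length A = p - 1" "\<forall>A'\<in>set As. length A' = p - 1" "p \<le> length B"
  proof -
    show "length A = p - 1" "p \<le> length B"
      using big el(3)[OF i0] p2 by (auto simp: A_def B_def)
    show "\<forall>A'\<in>set As. length A' = p - 1"
    proof
      fix A' assume "A' \<in> set As"
      then obtain i where i: "i \<in> set ks" "A' = take (p - 1) (el i)" by (auto simp: As_def)
      have "p \<le> length (el i)" using bspec[OF cC ksin(1)[OF i(1)]] el(3)[OF ksin(1)[OF i(1)]] by simp
      then show "length A' = p - 1" using i(2) by simp
    qed
  qed
  from chessboard_zero_in_hull[OF assms(1,2) this dist, of x]
  obtain s t where s: "length s = p" "distinct (map fst s)" "distinct (map snd s)"
      "set s \<subseteq> {..<p} \<times> set (A @ B)" and t: "t \<in> cells As [0..<p]"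
    and hull: "zero_in_hull ((p - 1) * Suc (length As)) (map (\<lambda>(i, v). tens p i (x v)) (s @ t))"
    by blast
  define u where "u = s @ t"
  let ?m = "length u"
  define R V where "R j = fst (u ! j)" and "V j = snd (u ! j)" for j
  have ssub: "snd ` set s \<subseteq> C i0" using s(4) unfolding AB el(1)[OF i0] by auto
  have dsnd: "distinct (map snd u)"
    unfolding u_def by (rule distinct_snd_append_cells[OF s(3) ssub t distAs disjA])
  have tsnd: "snd ` set t = set (concat As)" using mset_eq_setD[OF cells_snd[OF t]] by simp
  have uin: "i < p" "v < n" if "(i, v) \<in> set u" for i v
  proof -
    have "fst ` set t \<subseteq> {..<p}" using cells_fst[OF t] by auto
    then have "fst ` set u \<subseteq> {..<p}" using s(4) unfolding u_def by auto
    then show "i < p" using that by (metis image_subset_iff lessThan_iff fst_conv)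
    have "snd ` set u \<subseteq> {..<n}"
      using ssub tsnd concatAs Csub[OF i0] Csub ksin unfolding u_def by (simp only: set_append image_Un) blast
    then show "v < n" using that by (metis image_subset_iff lessThan_iff snd_conv)
  qed
  have RV: "(R j, V j) \<in> set u" if "j < ?m" for j using that by (simp add: R_def V_def)
  obtain l where l': "\<forall>j<?m. l j \<ge> 0" "(\<Sum>j<?m. l j) = 1"
    "\<forall>r<(p - 1) * (?d + 1). (\<Sum>j<?m. l j * (map (\<lambda>(i, v). tens p i (x v)) u ! j) r) = 0"
    using hull unfolding zero_in_hull_def u_def[symmetric] lenAs length_map Suc_eq_plus1 by (elim exE conjE)
  have l: "l j \<ge> 0" if "j < ?m" for j using l'(1) that by blast
  have rel: "(\<Sum>j<?m. l j * tens p (R j) (x (V j)) r) = 0" if r: "r < (p - 1) * (?d + 1)" for r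
  proof -
    have "(\<Sum>j<?m. l j * tens p (R j) (x (V j)) r)
        = (\<Sum>j<?m. l j * (map (\<lambda>(i, v). tens p i (x v)) u ! j) r)"
      by (intro sum.cong refl) (simp add: R_def V_def case_prod_beta)
    then show ?thesis using l'(3) r by (simp only:)
  qed
  define a where "a i k = (\<Sum>j<?m. if R j = i then l j * x (V j) k else 0)" for i k
  have a: "a i k = a 0 k" if "i < p" "k < ?d + 1" for i k
    unfolding a_def by (rule tens_relation[OF p2 that rel])
  have ad: "a i ?d = (\<Sum>j<?m. if R j = i then l j else 0)" for i
    unfolding a_def by (intro sum.cong) (auto simp: x_def)
  \<comment> \<open>The last coordinate of every \<open>x v\<close> is 1, so all rows carry the same
    total weight, namely 1/p; this is why \<open>y\<close> is scaled by \<open>p\<close>.\<close>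
  have mass: "real p * a i ?d = 1" if "i < p" for i
  proof -
    have "1 = (\<Sum>j<?m. \<Sum>i<p. if R j = i then l j else 0)"
    proof -
      have "(\<Sum>i<p. if R j = i then l j else 0) = l j" if "j < ?m" for j
        using uin(1)[OF RV[OF that]] by (simp add: sum.delta')
      then show ?thesis using l'(2) by simp
    qed
    also have "\<dots> = (\<Sum>i<p. a i ?d)"
      unfolding ad by (rule sum.swap)
    also have "\<dots> = (\<Sum>i<p. a 0 ?d)" by (intro sum.cong refl a) auto
    also have "\<dots> = real p * a 0 ?d" by (simp only: sum_constant card_lessThan)
    also have "a 0 ?d = a i ?d" by (rule a[OF that, symmetric]) (rule less_add_one)
    finally show ?thesis by (rule sym)
  qed
  define y where "y i v = (\<Sum>j<?m. if R j = i \<and> V j = v then real p * l j else 0)" for i v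
  \<comment> \<open>Faces are indexed from 1, rows from 0.\<close>
  define \<sigma> where "\<sigma> i = {v. (i - 1, v) \<in> set u}" for i
  have yface: "y i \<in> simplex_face n (\<sigma> (Suc i))" if "i < p" for i
  proof -
    have y0: "y i v \<ge> 0" for v unfolding y_def using l by (intro sum_nonneg) auto
    have yout: "y i v = 0" if "v \<notin> \<sigma> (Suc i)" for v
      unfolding y_def using that RV by (intro sum.neutral) (auto simp: \<sigma>_def)
    have \<sigma>n: "v < n" if "v \<in> \<sigma> (Suc i)" for v using that uin(2) by (auto simp: \<sigma>_def)
    have "(\<Sum>v<n. y i v) = (\<Sum>j<?m. \<Sum>v<n. if R j = i \<and> V j = v then real p * l j else 0)"
      unfolding y_def by (rule sum.swap)
    also have "\<dots> = (\<Sum>j<?m. if R j = i then real p * l j else 0)"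
    proof (intro sum.cong refl)
      fix j assume "j \<in> {..<?m}"
      then have "V j < n" using uin(2) RV by blast
      then show "(\<Sum>v<n. if R j = i \<and> V j = v then real p * l j else 0) = (if R j = i then real p * l j else 0)"
        by (cases "R j = i") (simp_all add: sum.delta')
    qed
    also have "\<dots> = real p * a i ?d"
      unfolding ad sum_distrib_left by (intro sum.cong) auto
    finally have ysum: "(\<Sum>v<n. y i v) = 1" using mass[OF that] by simp
    have "y i v \<le> 1" for v
      using member_le_sum[of v "{..<n}" "y i"] y0 ysum yout[of v] \<sigma>n[of v] by (cases "v < n") fastforce+
    moreover have "{..n - 1} = {..<n}" using n0 by auto
    ultimately show ?thesis
      using y0 ysum yout \<sigma>n unfolding simplex_face_def standard_simplex_def by fastforce
  qed
  have fy: "vec_nth (f (y i)) (h k) = real p * a i k" if "i < p" "k < ?d" for i k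
  proof -
    have "y i \<in> standard_simplex (n - 1)" using yface[OF that(1)] unfolding simplex_face_def by blast
    then have "f (y i) = (\<Sum>v<n. y i v *\<^sub>R f (e v))"
      using affine_map_on_simplex_eq_sum[OF f n0] unfolding e_def by simp
    then have "vec_nth (f (y i)) (h k) = (\<Sum>v<n. y i v * x v k)"
      using that(2) by (simp add: x_def)
    also have "\<dots> = (\<Sum>v<n. \<Sum>j<?m. if R j = i \<and> V j = v then real p * l j * x v k else 0)"
      unfolding y_def sum_distrib_right by (intro sum.cong) auto
    also have "\<dots> = (\<Sum>j<?m. \<Sum>v<n. if R j = i \<and> V j = v then real p * l j * x v k else 0)"
      by (rule sum.swap)
    also have "\<dots> = (\<Sum>j<?m. real p * (if R j = i then l j * x (V j) k else 0))"
    proof (intro sum.cong refl)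
      fix j assume "j \<in> {..<?m}"
      then have "V j < n" using uin(2) RV by blast
      then show "(\<Sum>v<n. if R j = i \<and> V j = v then real p * l j * x v k else 0)
          = real p * (if R j = i then l j * x (V j) k else 0)"
        by (cases "R j = i") (simp_all add: sum.delta')
    qed
    finally show ?thesis by (simp add: a_def sum_distrib_left)
  qed
  have feq: "f (y i) = f (y 0)" if "i < p" for i
  proof -
    have "vec_nth (f (y i)) c = vec_nth (f (y 0)) c" for c
    proof -
      have "c \<in> h ` {0..<?d}" using bij_betw_imp_surj_on[OF h] by simp
      then obtain k where k: "k < ?d" "c = h k" by auto
      have "vec_nth (f (y i)) c = real p * a i k" unfolding k(2) by (rule fy[OF that k(1)])
      also have "\<dots> = real p * a 0 k" using k(1) by (intro arg_cong[where f = "(*) (real p)"] a that) (erule trans_less_add1)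
      also have "\<dots> = vec_nth (f (y 0)) c" unfolding k(2) by (rule fy[OF _ k(1), symmetric]) (use p2 in simp)
      finally show ?thesis .
    qed
    then show ?thesis by (simp add: Finite_Cartesian_Product.vec_eq_iff)
  qed
  have "f (y 0) \<in> f ` simplex_face n (\<sigma> j)" if j: "j \<in> {1..p}" for j
  proof -
    obtain i where "j = Suc i" "i < p" using j by (cases j) auto
    then show ?thesis using yface[of i] feq[of i] by (metis imageI)
  qed
  then have "f (y 0) \<in> (\<Inter>j\<in>{1..p}. f ` simplex_face n (\<sigma> j))" by blast
  then have inter: "(\<Inter>j\<in>{1..p}. f ` simplex_face n (\<sigma> j)) \<noteq> {}" by blast
  have disj: "disjoint_family_on \<sigma> {1..p}"
    unfolding disjoint_family_on_def
  proof (intro ballI impI)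
    fix i j assume ij: "i \<in> {1..p}" "j \<in> {1..p}" "i \<noteq> j"
    have False if "(i - 1, v) \<in> set u" "(j - 1, v) \<in> set u" for v
    proof -
      have "inj_on snd (set u)" using dsnd by (simp add: distinct_map)
      then have "i - 1 = j - 1" using that by (metis inj_onD fst_conv snd_conv)
      then show False using ij by auto
    qed
    then show "\<sigma> i \<inter> \<sigma> j = {}" by (auto simp: \<sigma>_def)
  qed
  have rain: "rainbow (?d + 1) C (\<sigma> j)" for j
    unfolding rainbow_def
  proof
    fix c assume c: "c \<in> {1..?d + 1}"
    \<comment> \<open>Vertices of the split color lie in \<open>s\<close>, those of other colors in
      \<open>t\<close>; within either part a row meets a color at most once.\<close>
    have "v = v'" if v: "(i, v) \<in> set u" "(i, v') \<in> set u" "v \<in> C c" "v' \<in> C c" for i v v'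
    proof (cases "c = i0")
      case True
      then have "v \<notin> snd ` set t" "v' \<notin> snd ` set t" using v(3,4) disjA tsnd by blast+
      then have "(i, v) \<in> set s" "(i, v') \<in> set s" using v(1,2) by (auto simp: u_def image_iff)
      then show ?thesis using s(2) by (metis eq_key_imp_eq_value)
    next
      case False
      moreover have "c \<in> set (i0 # ks)" unfolding ks(2) by (rule c)
      ultimately have ck: "c \<in> set ks" by simp
      have "C c \<inter> C i0 = {}" using Cdisj[OF c i0 False] .
      then have "v \<notin> snd ` set s" "v' \<notin> snd ` set s" using v(3,4) ssub by blast+
      then have vt: "(i, v) \<in> set t" "(i, v') \<in> set t" using v(1,2) by (auto simp: u_def image_iff)
      have *: "w \<in> set (take (p - 1) (el c))" if w: "(i, w) \<in> set t" "w \<in> C c" for w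
      proof -
        have "w \<in> set (concat As)" unfolding tsnd[symmetric] using w(1) by (rule image_eqI[rotated]) simp
        then obtain c' where c': "c' \<in> set ks" "w \<in> set (take (p - 1) (el c'))" by (auto simp: As_def)
        then have "w \<in> C c'" using Asub[OF ksin(1)[OF c'(1)]] by blast
        then have "c' = c" using Cdisj[of c' c] ksin(1)[OF c'(1)] c w(2) by blast
        then show ?thesis using c'(2) by simp
      qed
      have "take (p - 1) (el c) \<in> set As" using ck by (simp add: As_def)
      then show ?thesis
        using cells_block_unique[OF t _ distAs _ vt] * vt v(3,4) by simp
    qed
    then have "\<exists>w. \<sigma> j \<inter> C c \<subseteq> {w}" unfolding \<sigma>_def by blast
    then obtain w where "\<sigma> j \<inter> C c \<subseteq> {w}" ..
    then show "card (\<sigma> j \<inter> C c) \<le> 1" using card_mono[of "{w}"] by fastforce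
  qed
  have "\<sigma> j \<subseteq> {..<n}" for j using uin(2) by (auto simp: \<sigma>_def)
  then show "\<exists>\<sigma>. (\<forall>j\<in>{1..p}. \<sigma> j \<subseteq> {..<n} \<and> rainbow (?d + 1) C (\<sigma> j)) \<and>
      disjoint_family_on \<sigma> {1..p} \<and> (\<Inter>j\<in>{1..p}. f ` simplex_face n (\<sigma> j)) \<noteq> {}"
    using rain disj inter by (intro exI[of _ \<sigma>]) simp
qed

theorem theorem6p13:
  fixes p :: nat
  assumes "prime p" and "odd p"
  shows "colored_tverberg_number TYPE('d::finite) p
           \<le> enat ((CARD('d) + 1) * (2 * p - 2) + 1)"
proof -
  let ?n = "(CARD('d) + 1) * (2 * p - 2) + 1"
  \<comment> \<open>This places the bound among the \<open>n\<close> over which the minimum is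
    taken.\<close>
  have "p \<le> 2 * p - 2" using prime_ge_2_nat[OF assms(1)] by simp
  then have "(CARD('d) + 1) * p \<le> (CARD('d) + 1) * (2 * p - 2)" by (rule mult_le_mono2)
  then have "(CARD('d) + 1) * p \<le> ?n" by (rule trans_le_add1)
  moreover have "?n > (CARD('d) + 1) * (2 * (p - 1))"
    by (simp only: diff_mult_distrib2 mult_1_right less_add_one)
  then have "colored_tverberg_property TYPE('d) p ?n"
    by (rule colored_tverberg_property_prime[OF assms])
  ultimately show ?thesis
    unfolding colored_tverberg_number_def by (intro Inf_lower imageI CollectI conjI)
qed

end
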